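(* Let $\textup{AC}_m$ denote the class of monotone arithmetic circuits, with the class notation and the succinctness relations $\le, <, \simeq$ defined in the context. Then all of the following hold: (i) $\textup{wD-AC}_m < \textup{D-AC}_m$, $\textup{wD-AC}_m < \textup{swD-AC}_m$ and $\textup{wD-AC}_m < \textup{dwD-AC}_m$; (ii) $\textup{D-AC}_m \simeq \textup{sD-AC}_m \simeq \textup{swD-AC}_m$; (iii) $\textup{D-AC}_m < \textup{dD-AC}_m$, $\textup{sD-AC}_m < \textup{sdD-AC}_m$ and $\textup{swD-AC}_m < \textup{sdwD-AC}_m$; (iv) $\textup{dwD-AC}_m < \textup{dD-AC}_m$ and $\textup{dwD-AC}_m < \textup{sdwD-AC}_m$; (v) $\textup{dD-AC}_m \simeq \textup{sdD-AC}_m \simeq \textup{sdwD-AC}_m$; (vi) $\textup{dwD-AC}_m$ and $\textup{D-AC}_m$ are incomparable, i.e. $\textup{dwD-AC}_m \not\le \textup{D-AC}_m$ and $\textup{D-AC}_m \not\le \textup{dwD-AC}_m$.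
   Context: An arithmetic circuit (AC) is a finite directed acyclic graph with a single source, whose sinks (inputs) are each labeled by a real constant, by a variable $x$ with values in $\{0,1\}$, or by a complemented variable $\overline{x}$ (evaluating to $1-x$), and whose internal nodes each have exactly two successors $g_l,g_r$ and are labeled $+$ or $\times$. The size $|C|$ is the number of nodes. For a node $g$, $\mathit{var}(g)$ is the set of variables $x$ such that $x$ or $\overline{x}$ labels a sink reachable from $g$; $\mathit{var}(C)$ is $\mathit{var}$ of the source. $C$ computes a real-valued function of assignments $\mathit{var}(C)\to\{0,1\}$ by bottom-up evaluation. For a node $g$, $\mathit{supp}(g)$ is the set of assignments to $\mathit{var}(g)$ on which the subcircuit rooted at $g$ evaluates to a nonzero value. A $+$-node $g$ is smooth if $\mathit{var}(g_l)=\mathit{var}(g_r)$, and deterministic if there is no assignment $a$ to $\mathit{var}(g)$ whose restrictions to $\mathit{var}(g_l)$ and $\mathit{var}(g_r)$ lie in $\mathit{supp}(g_l)$ and $\mathit{supp}(g_r)$ respectively. A $\times$-node $g$ is decomposable if $\mathit{var}(g_l)\cap\mathit{var}(g_r)=\emptyset$, and weakly decomposable if every $x\in\mathit{var}(g_l)\cap\mathit{var}(g_r)$ appears with a unique polarity below $g$ (not both $x$ and $\overline{x}$ label sinks reachable from $g$). An AC is smooth (resp. deterministic) if all its $+$-nodes are, and decomposable (resp. weakly decomposable) if all its $\times$-nodes are. An AC is monotone if all its constant inputs are nonnegative. Class names combine prefixes: s = smooth, d = deterministic, D = decomposable, wD = weakly decomposable; e.g. $\textup{sdwD-AC}_m$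 is the class of smooth deterministic weakly decomposable monotone AC. Succinctness: for classes $\mathcal{C}_1,\mathcal{C}_2$, $\mathcal{C}_1\le\mathcal{C}_2$ if there is a polynomial $p$ such that for every $C_2\in\mathcal{C}_2$ there is $C_1\in\mathcal{C}_1$ computing the same function with $|C_1|\le p(|C_2|)$; $\mathcal{C}_1<\mathcal{C}_2$ means $\mathcal{C}_1\le\mathcal{C}_2$ and $\mathcal{C}_2\not\le\mathcal{C}_1$; $\mathcal{C}_1\simeq\mathcal{C}_2$ means both $\mathcal{C}_1\le\mathcal{C}_2$ and $\mathcal{C}_2\le\mathcal{C}_1$. *)

theory Defs
  imports Complex_Main "HOL-Library.FuncSet" "HOL-Computational_Algebra.Polynomial"
begin

section \<open>Arithmetic circuits\<close>

text \<open>
  Both the variables and the nodes of a circuit are named by natural numbers.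
  A gate carries the label of its node and, for an internal node, its two successors.
  What \<open>gate\<close> does outside \<open>nodes\<close> is irrelevant.
\<close>

datatype gate =
    Const real
  | PosLit nat
  | NegLit nat
  | Plus nat nat
  | Times nat nat

fun gate_succs :: "gate \<Rightarrow> nat set" where
  "gate_succs (Plus l r) = {l, r}"
| "gate_succs (Times l r) = {l, r}"
| "gate_succs _ = {}"

record circuit =
  nodes :: "nat set"
  gate :: "nat \<Rightarrow> gate"

definition edges :: "circuit \<Rightarrow> (nat \<times> nat) set" where
  "edges C = {(g, h). g \<in> nodes C \<and> h \<in> gate_succs (gate C g)}"

definition is_source :: "circuit \<Rightarrow> nat \<Rightarrow> bool" where
  "is_source C g \<longleftrightarrow> g \<in> nodes C \<and> (\<forall>h. (h, g) \<notin> edges C)"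

text \<open>
  The last condition says that an internal node has exactly two successors: the graph is simple,
  so the left and the right successor are distinct nodes.
\<close>

definition is_ac :: "circuit \<Rightarrow> bool" where
  "is_ac C \<longleftrightarrow>
     finite (nodes C) \<and>
     edges C \<subseteq> nodes C \<times> nodes C \<and>
     acyclic (edges C) \<and>
     (\<exists>!s. is_source C s) \<and>
     (\<forall>g\<in>nodes C. \<forall>l r. gate C g = Plus l r \<or> gate C g = Times l r \<longrightarrow> l \<noteq> r)"

definition source :: "circuit \<Rightarrow> nat" where
  "source C = (THE s. is_source C s)"

definition ac_size :: "circuit \<Rightarrow> nat" where
  "ac_size C = card (nodes C)"

text \<open>The variables that label a sink reachable from a node, by polarity of the label.\<close>

definition pos_var :: "circuit \<Rightarrow> nat \<Rightarrow> nat set" where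
  "pos_var C g = {x. \<exists>h\<in>nodes C. (g, h) \<in> (edges C)\<^sup>* \<and> gate C h = PosLit x}"

definition neg_var :: "circuit \<Rightarrow> nat \<Rightarrow> nat set" where
  "neg_var C g = {x. \<exists>h\<in>nodes C. (g, h) \<in> (edges C)\<^sup>* \<and> gate C h = NegLit x}"

definition node_var :: "circuit \<Rightarrow> nat \<Rightarrow> nat set" where
  "node_var C g = pos_var C g \<union> neg_var C g"

definition ac_var :: "circuit \<Rightarrow> nat set" where
  "ac_var C = node_var C (source C)"


section \<open>Semantics\<close>

definition assignments :: "nat set \<Rightarrow> (nat \<Rightarrow> real) set" where
  "assignments X = X \<rightarrow>\<^sub>E {0, 1}"

text \<open>
  Bottom-up evaluation. The guard only serves termination; the value is a dummy if \<open>C\<close> is not a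
  circuit or \<open>g\<close> is not one of its nodes.
\<close>

function node_val :: "circuit \<Rightarrow> (nat \<Rightarrow> real) \<Rightarrow> nat \<Rightarrow> real" where
  "node_val C a g =
     (if is_ac C \<and> g \<in> nodes C then
        (case gate C g of
           Const c \<Rightarrow> c
         | PosLit x \<Rightarrow> a x
         | NegLit x \<Rightarrow> 1 - a x
         | Plus l r \<Rightarrow> node_val C a l + node_val C a r
         | Times l r \<Rightarrow> node_val C a l * node_val C a r)
      else 0)"
  by auto
termination
proof (relation "{((C', a', h), (C, a, g)). C' = C \<and> is_ac C \<and> (g, h) \<in> edges C}")
  let ?R = "{((C', a', h), (C, a, g)). C' = C \<and> is_ac C \<and> (g, h) \<in> edges C}
              :: ((circuit \<times> (nat \<Rightarrow> real) \<times> nat) \<times> circuit \<times> (nat \<Rightarrow> real) \<times> nat) set"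
  have wf_edges: "wf ((edges C)\<inverse>)" if "is_ac C" for C
  proof (rule finite_acyclic_wf_converse)
    show "finite (edges C)"
      using that unfolding is_ac_def by (meson finite_SigmaI finite_subset)
    show "acyclic (edges C)"
      using that unfolding is_ac_def by blast
  qed
  show "wf ?R"
    unfolding wf_def
  proof (intro allI impI)
    fix P and p :: "circuit \<times> (nat \<Rightarrow> real) \<times> nat"
    assume step: "\<forall>p. (\<forall>q. (q, p) \<in> ?R \<longrightarrow> P q) \<longrightarrow> P p"
    have P_C: "P (C, a, g)" if C: "is_ac C" for C a g
      using wf_edges[OF C]
    proof (induction g arbitrary: a rule: wf_induct_rule)
      case (less g a)
      show ?case
      proof (rule step[rule_format])
        fix q assume "(q, C, a, g) \<in> ?R"
        then obtain a' h where "q = (C, a', h)" "(g, h) \<in> edges C" by blast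
        then show "P q" using less by simp
      qed
    qed
    have P_not: "P (C, a, g)" if "\<not> is_ac C" for C a g
      by (rule step[rule_format]) (use that in blast)
    obtain C a g where "p = (C, a, g)" by (rule prod_cases3)
    then show "P p" using P_C P_not by blast
  qed
qed (auto simp: edges_def)

declare node_val.simps [simp del]

definition supp :: "circuit \<Rightarrow> nat \<Rightarrow> (nat \<Rightarrow> real) set" where
  "supp C g = {a \<in> assignments (node_var C g). node_val C a g \<noteq> 0}"

text \<open>
  A circuit computes a function with domain \<open>assignments (ac_var C)\<close>, so two circuits that compute
  the same function have the same variables.
\<close>

definition same_function :: "circuit \<Rightarrow> circuit \<Rightarrow> bool" where
  "same_function C D \<longleftrightarrow>
     ac_var C = ac_var D \<and>
     (\<forall>a\<in>assignments (ac_var C). node_val C a (source C) = node_val D a (source D))"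


section \<open>Structural restrictions\<close>

definition smooth :: "circuit \<Rightarrow> bool" where
  "smooth C \<longleftrightarrow>
     (\<forall>g\<in>nodes C. \<forall>l r. gate C g = Plus l r \<longrightarrow> node_var C l = node_var C r)"

definition deterministic :: "circuit \<Rightarrow> bool" where
  "deterministic C \<longleftrightarrow>
     (\<forall>g\<in>nodes C. \<forall>l r. gate C g = Plus l r \<longrightarrow>
        \<not> (\<exists>a\<in>assignments (node_var C g).
             restrict a (node_var C l) \<in> supp C l \<and> restrict a (node_var C r) \<in> supp C r))"

definition decomposable :: "circuit \<Rightarrow> bool" where
  "decomposable C \<longleftrightarrow>
     (\<forall>g\<in>nodes C. \<forall>l r. gate C g = Times l r \<longrightarrow> node_var C l \<inter> node_var C r = {})"

definition weakly_decomposable :: "circuit \<Rightarrow> bool" where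
  "weakly_decomposable C \<longleftrightarrow>
     (\<forall>g\<in>nodes C. \<forall>l r. gate C g = Times l r \<longrightarrow>
        (\<forall>x\<in>node_var C l \<inter> node_var C r. \<not> (x \<in> pos_var C g \<and> x \<in> neg_var C g)))"

definition monotone_ac :: "circuit \<Rightarrow> bool" where
  "monotone_ac C \<longleftrightarrow> (\<forall>g\<in>nodes C. \<forall>c. gate C g = Const c \<longrightarrow> c \<ge> 0)"

definition ACm :: "circuit set" where
  "ACm = {C. is_ac C \<and> monotone_ac C}"

definition D_ACm :: "circuit set" where
  "D_ACm = {C \<in> ACm. decomposable C}"

definition sD_ACm :: "circuit set" where
  "sD_ACm = {C \<in> ACm. smooth C \<and> decomposable C}"

definition dD_ACm :: "circuit set" where
  "dD_ACm = {C \<in> ACm. deterministic C \<and> decomposable C}"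

definition sdD_ACm :: "circuit set" where
  "sdD_ACm = {C \<in> ACm. smooth C \<and> deterministic C \<and> decomposable C}"

definition wD_ACm :: "circuit set" where
  "wD_ACm = {C \<in> ACm. weakly_decomposable C}"

definition swD_ACm :: "circuit set" where
  "swD_ACm = {C \<in> ACm. smooth C \<and> weakly_decomposable C}"

definition dwD_ACm :: "circuit set" where
  "dwD_ACm = {C \<in> ACm. deterministic C \<and> weakly_decomposable C}"

definition sdwD_ACm :: "circuit set" where
  "sdwD_ACm = {C \<in> ACm. smooth C \<and> deterministic C \<and> weakly_decomposable C}"


section \<open>Succinctness\<close>

text \<open>The smaller class is the more succinct one.\<close>

definition succ_le :: "circuit set \<Rightarrow> circuit set \<Rightarrow> bool"  (infix "\<le>\<^sub>s" 50) where
  "K1 \<le>\<^sub>s K2 \<longleftrightarrow>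
     (\<exists>p :: real poly. \<forall>C2\<in>K2. \<exists>C1\<in>K1.
        same_function C1 C2 \<and> real (ac_size C1) \<le> poly p (real (ac_size C2)))"

definition succ_less :: "circuit set \<Rightarrow> circuit set \<Rightarrow> bool"  (infix "<\<^sub>s" 50) where
  "K1 <\<^sub>s K2 \<longleftrightarrow> K1 \<le>\<^sub>s K2 \<and> \<not> K2 \<le>\<^sub>s K1"

definition succ_equiv :: "circuit set \<Rightarrow> circuit set \<Rightarrow> bool"  (infix "\<simeq>\<^sub>s" 50) where
  "K1 \<simeq>\<^sub>s K2 \<longleftrightarrow> K1 \<le>\<^sub>s K2 \<and> K2 \<le>\<^sub>s K1"

end

theory Submission
  imports Defs "HOL-Library.Countable" "HOL-Analysis.Continuum_Not_Denumerable"
    "HOL-Analysis.Finite_Cartesian_Product"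
begin

text \<open>
  Smoothing multiplies the operands of a sum by factors $x + \overline{x}$. In a smooth weakly
  decomposable circuit, a variable of unique polarity below a node is a factor of the polynomial of
  that node; setting it to 1 there and restoring the factor at the sums above makes all products
  decomposable. Both changes keep determinism.

  All separations reduce to (vi) by transitivity. In a deterministic circuit every nonzero value is a
  product of constants of the circuit, so few values are multiplicatively independent; but
  $t + \sum_{i<n} 2^i x_i$ has $2^n$ independent values for suitable $t$. Conversely, let
  $n$ selectors choose among $2n$ columns, and require that every chosen column is switched on.
  Inputs that switch on exactly the chosen columns are distributed among the nodes of a decomposable
  circuit that read about half of the selected literals. Two inputs at the same node may be mixed,
  which confines each selector of one side to at most $3/4$ of the columns.
\<close>

section \<open>Evaluation and variables by recursion on the gates\<close>

text \<open>Since \<open>same_function\<close> also compares variable sets, no variable may vanish: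
  smoothing only repeats variables already present, and every removed literal returns on an edge or
  at the root. Both transformations thus put factors on edges, and one padding construction serves
  both. Its size is cubic: quadratically many edges, each with linearly many factors.

  Against determinism, counting distinct values would not do, because a product of n two-valued
  factors can already take 2^n values; hence multiplicative independence. Against decomposability,
  smoothness and monotonicity allow a descent along nodes that contribute to an input, down to a
  node that reads between k and 2k of the n = 3k selected literals, so each side holds at least k
  selectors. The fraction 3/4 comes from the 2n columns: a reference input switches on at most n of
  them, the sets of columns left to the two sides have total size at most 2n + n, and the smaller
  has at most 3n/2.\<close>

lemma ac_finite: "is_ac C \<Longrightarrow> finite (nodes C)"
  by (simp add: is_ac_def)

lemma ac_wf: "is_ac C \<Longrightarrow> wf ((edges C)\<inverse>)"
  unfolding is_ac_def by (meson finite_SigmaI finite_acyclic_wf_converse finite_subset)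

lemma ac_succ: "\<lbrakk>is_ac C; g \<in> nodes C; h \<in> gate_succs (gate C g)\<rbrakk> \<Longrightarrow> h \<in> nodes C"
  unfolding is_ac_def edges_def by blast

lemma ac_distinct:
  "\<lbrakk>is_ac C; g \<in> nodes C; gate C g = Plus l r \<or> gate C g = Times l r\<rbrakk> \<Longrightarrow> l \<noteq> r"
  unfolding is_ac_def by blast

lemma ac_source:
  assumes "is_ac C" shows "is_source C (source C)" "source C \<in> nodes C"
proof -
  show "is_source C (source C)"
    using assms unfolding is_ac_def source_def by (metis theI')
  then show "source C \<in> nodes C"
    by (simp add: is_source_def)
qed

lemma ac_induct [consumes 2, case_names node]:
  assumes "is_ac C" "g \<in> nodes C"
    and step: "\<And>g. \<lbrakk>g \<in> nodes C; \<And>h. h \<in> gate_succs (gate C g) \<Longrightarrow> P h\<rbrakk> \<Longrightarrow> P g"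
  shows "P g"
  using ac_wf[OF assms(1)] assms(2)
proof (induction g rule: wf_induct_rule)
  case (less g)
  show ?case
    by (rule step[OF less.prems])
      (use less ac_succ[OF assms(1)] in \<open>auto simp: edges_def\<close>)
qed

lemma node_val_gate:
  assumes "is_ac C" "g \<in> nodes C"
  shows "node_val C a g = (case gate C g of Const c \<Rightarrow> c | PosLit x \<Rightarrow> a x | NegLit x \<Rightarrow> 1 - a x
      | Plus l r \<Rightarrow> node_val C a l + node_val C a r
      | Times l r \<Rightarrow> node_val C a l * node_val C a r)"
  using assms by (subst node_val.simps) simp

text \<open>Constructed circuits are evaluated by guessing \<open>V\<close>: the gate equations
  determine the values from the sinks up.\<close>

lemma node_val_unique:
  assumes "is_ac C" "g \<in> nodes C"
    and "\<And>g. g \<in> nodes C \<Longrightarrow> V g = (case gate C g of Const c \<Rightarrow> c | PosLit x \<Rightarrow> a x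
      | NegLit x \<Rightarrow> 1 - a x | Plus l r \<Rightarrow> V l + V r | Times l r \<Rightarrow> V l * V r)"
  shows "node_val C a g = V g"
  using assms(1,2)
proof (induction rule: ac_induct)
  case (node g)
  show ?case
    unfolding assms(3)[OF node(1)] node_val_gate[OF assms(1) node(1)]
    using node(2) by (auto split: gate.split)
qed

lemma reach_unfold:
  assumes "g \<in> nodes C"
  shows "(g, h) \<in> (edges C)\<^sup>* \<longleftrightarrow> h = g \<or> (\<exists>k\<in>gate_succs (gate C g). (k, h) \<in> (edges C)\<^sup>*)"
  using assms by (auto simp: edges_def elim: converse_rtranclE intro: converse_rtrancl_into_rtrancl)

lemma pos_var_gate:
  assumes "is_ac C" "g \<in> nodes C"
  shows "pos_var C g = (case gate C g of PosLit x \<Rightarrow> {x} | Plus l r \<Rightarrow> pos_var C l \<union> pos_var C r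
      | Times l r \<Rightarrow> pos_var C l \<union> pos_var C r | _ \<Rightarrow> {})"
  using assms(2) unfolding pos_var_def
  by (auto simp: reach_unfold[OF assms(2)] split: gate.split)

lemma neg_var_gate:
  assumes "is_ac C" "g \<in> nodes C"
  shows "neg_var C g = (case gate C g of NegLit x \<Rightarrow> {x} | Plus l r \<Rightarrow> neg_var C l \<union> neg_var C r
      | Times l r \<Rightarrow> neg_var C l \<union> neg_var C r | _ \<Rightarrow> {})"
  using assms(2) unfolding neg_var_def
  by (auto simp: reach_unfold[OF assms(2)] split: gate.split)

lemma node_var_gate:
  assumes "is_ac C" "g \<in> nodes C"
  shows "node_var C g = (case gate C g of Const c \<Rightarrow> {} | PosLit x \<Rightarrow> {x} | NegLit x \<Rightarrow> {x}
      | Plus l r \<Rightarrow> node_var C l \<union> node_var C r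
      | Times l r \<Rightarrow> node_var C l \<union> node_var C r)"
  unfolding node_var_def pos_var_gate[OF assms] neg_var_gate[OF assms]
  by (auto split: gate.split)

text \<open>The label sets \<open>p x\<close> and \<open>n x\<close> are parameters so that one
  induction covers \<open>node_var\<close>, \<open>pos_var\<close> and
  \<open>neg_var\<close>.\<close>

lemma var_unique:
  assumes "is_ac C" "g \<in> nodes C"
    and F: "\<And>g. g \<in> nodes C \<Longrightarrow> F g = (case gate C g of Const c \<Rightarrow> {} | PosLit x \<Rightarrow> p x | NegLit x \<Rightarrow> n x
      | Plus l r \<Rightarrow> F l \<union> F r | Times l r \<Rightarrow> F l \<union> F r)"
    and G: "\<And>g. g \<in> nodes C \<Longrightarrow> G g = (case gate C g of Const c \<Rightarrow> {} | PosLit x \<Rightarrow> p x | NegLit x \<Rightarrow> n x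
      | Plus l r \<Rightarrow> G l \<union> G r | Times l r \<Rightarrow> G l \<union> G r)"
  shows "F g = G g"
  using assms(1,2)
proof (induction rule: ac_induct)
  case (node g)
  show ?case
    unfolding F[OF node(1)] G[OF node(1)] using node(2) by (auto split: gate.split)
qed

lemma node_var_unique:
  assumes "is_ac C" "g \<in> nodes C"
    and "\<And>g. g \<in> nodes C \<Longrightarrow> F g = (case gate C g of Const c \<Rightarrow> {} | PosLit x \<Rightarrow> {x} | NegLit x \<Rightarrow> {x}
      | Plus l r \<Rightarrow> F l \<union> F r | Times l r \<Rightarrow> F l \<union> F r)"
  shows "node_var C g = F g"
  by (rule var_unique[OF assms(1,2) node_var_gate[OF assms(1)] assms(3)])

lemma pos_var_unique:
  assumes "is_ac C" "g \<in> nodes C"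
    and "\<And>g. g \<in> nodes C \<Longrightarrow> F g = (case gate C g of Const c \<Rightarrow> {} | PosLit x \<Rightarrow> {x} | NegLit x \<Rightarrow> {}
      | Plus l r \<Rightarrow> F l \<union> F r | Times l r \<Rightarrow> F l \<union> F r)"
  shows "pos_var C g = F g"
  by (rule var_unique[OF assms(1,2) _ assms(3)])
    (auto simp: pos_var_gate[OF assms(1)] split: gate.split)

lemma neg_var_unique:
  assumes "is_ac C" "g \<in> nodes C"
    and "\<And>g. g \<in> nodes C \<Longrightarrow> F g = (case gate C g of Const c \<Rightarrow> {} | PosLit x \<Rightarrow> {} | NegLit x \<Rightarrow> {x}
      | Plus l r \<Rightarrow> F l \<union> F r | Times l r \<Rightarrow> F l \<union> F r)"
  shows "neg_var C g = F g"
  by (rule var_unique[OF assms(1,2) _ assms(3)])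
    (auto simp: neg_var_gate[OF assms(1)] split: gate.split)

lemma node_val_cong:
  assumes "is_ac C" "g \<in> nodes C" "\<And>x. x \<in> node_var C g \<Longrightarrow> a x = b x"
  shows "node_val C a g = node_val C b g"
  using assms
proof (induction rule: ac_induct)
  case (node g)
  have IH: "node_val C a h = node_val C b h"
    if "h \<in> gate_succs (gate C g)" "node_var C h \<subseteq> node_var C g" for h
    using node that by blast
  show ?case
    using node.prems IH unfolding node_val_gate[OF assms(1) node(1)] node_var_gate[OF assms(1) node(1)]
    by (auto split: gate.splits)
qed

lemma node_val_restrict:
  "\<lbrakk>is_ac C; g \<in> nodes C; node_var C g \<subseteq> X\<rbrakk> \<Longrightarrow> node_val C (restrict a X) g = node_val C a g"
  by (rule node_val_cong) auto

lemma node_val_nonneg: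
  assumes "is_ac C" "monotone_ac C" "g \<in> nodes C" "\<And>x. a x \<in> {0, 1}"
  shows "node_val C a g \<ge> 0"
  using assms(1,3)
proof (induction rule: ac_induct)
  case (node g)
  have "0 \<le> a x \<and> a x \<le> 1" for x
    using assms(4)[of x] by auto
  then show ?case
    using node assms(2) unfolding node_val_gate[OF assms(1) node(1)] monotone_ac_def
    by (auto split: gate.splits)
qed

text \<open>Circuits only read their variables, so total assignments can replace extensional ones.\<close>

lemma deterministic_iff:
  assumes "is_ac C"
  shows "deterministic C \<longleftrightarrow> (\<forall>g\<in>nodes C. \<forall>l r a. gate C g = Plus l r \<longrightarrow> (\<forall>x. a x \<in> {0, 1}) \<longrightarrow>
      node_val C a l = 0 \<or> node_val C a r = 0)" (is "_ \<longleftrightarrow> ?R")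
proof
  assume D: "deterministic C"
  show ?R
  proof (intro ballI allI impI)
    fix g l r and a :: "nat \<Rightarrow> real"
    assume g: "g \<in> nodes C" "gate C g = Plus l r" and a: "\<forall>x. a x \<in> {0, 1}"
    let ?b = "restrict a (node_var C g)"
    have lr: "l \<in> nodes C" "r \<in> nodes C"
      using ac_succ[OF assms g(1)] g(2) by auto
    have sub: "node_var C l \<subseteq> node_var C g" "node_var C r \<subseteq> node_var C g"
      using node_var_gate[OF assms g(1)] g(2) by auto
    have "?b \<in> assignments (node_var C g)"
      using a by (auto simp: assignments_def)
    then have "\<not> (restrict ?b (node_var C l) \<in> supp C l \<and> restrict ?b (node_var C r) \<in> supp C r)"
      using D g unfolding deterministic_def by blast
    then show "node_val C a l = 0 \<or> node_val C a r = 0"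
      using a sub by (auto simp: supp_def assignments_def node_val_restrict[OF assms] lr Int_absorb1)
  qed
next
  assume R: ?R
  show "deterministic C"
    unfolding deterministic_def
  proof (intro ballI allI impI notI, elim bexE conjE)
    fix g l r a
    assume g: "g \<in> nodes C" "gate C g = Plus l r" and a: "a \<in> assignments (node_var C g)"
      and s: "restrict a (node_var C l) \<in> supp C l" "restrict a (node_var C r) \<in> supp C r"
    \<comment> \<open>Outside \<open>node_var C g\<close> the extensional \<open>a\<close> is
      \<open>undefined\<close>, which need not be 0 or 1; hence the extension by 0.\<close>
    let ?b = "\<lambda>x. if x \<in> node_var C g then a x else 0"
    have lr: "l \<in> nodes C" "r \<in> nodes C"
      using ac_succ[OF assms g(1)] g(2) by auto
    have sub: "node_var C l \<subseteq> node_var C g" "node_var C r \<subseteq> node_var C g"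
      using node_var_gate[OF assms g(1)] g(2) by auto
    have "\<forall>x. ?b x \<in> {0, 1}"
      using a by (auto simp: assignments_def)
    then have "node_val C ?b l = 0 \<or> node_val C ?b r = 0"
      using R[rule_format, OF g, of ?b] by blast
    moreover have "node_val C ?b h = node_val C a h" if "h \<in> {l, r}" for h
      by (rule node_val_cong[OF assms]) (use that lr sub in auto)
    ultimately show False
      using s lr by (auto simp: supp_def node_val_restrict[OF assms])
  qed
qed

lemma same_function_iff:
  assumes "is_ac C" "is_ac D"
  shows "same_function C D \<longleftrightarrow> ac_var C = ac_var D \<and>
    (\<forall>a. (\<forall>x. a x \<in> {0, 1}) \<longrightarrow> node_val C a (source C) = node_val D a (source D))" (is "_ \<longleftrightarrow> ?R")
proof
  assume S: "same_function C D"
  show ?R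
  proof (intro conjI allI impI)
    show "ac_var C = ac_var D"
      using S by (simp add: same_function_def)
    fix a :: "nat \<Rightarrow> real"
    assume "\<forall>x. a x \<in> {0, 1}"
    then have "restrict a (ac_var C) \<in> assignments (ac_var C)"
      by (auto simp: assignments_def)
    then have "node_val C (restrict a (ac_var C)) (source C) = node_val D (restrict a (ac_var C)) (source D)"
      using S by (auto simp: same_function_def)
    then show "node_val C a (source C) = node_val D a (source D)"
      using S by (simp add: node_val_restrict assms ac_source ac_var_def same_function_def)
  qed
next
  assume R: ?R
  show "same_function C D"
    unfolding same_function_def
  proof (intro conjI ballI)
    show "ac_var C = ac_var D"
      using R by simp
    fix a assume a: "a \<in> assignments (ac_var C)"
    let ?b = "\<lambda>x. if x \<in> ac_var C then a x else 0"
    have "\<forall>x. ?b x \<in> {0, 1}"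
      using a by (auto simp: assignments_def)
    then have "node_val C ?b (source C) = node_val D ?b (source D)"
      using R by auto
    moreover have "node_val C ?b (source C) = node_val C a (source C)"
      by (rule node_val_cong) (auto simp: assms ac_source ac_var_def)
    moreover have "node_val D ?b (source D) = node_val D a (source D)"
      by (rule node_val_cong) (use R in \<open>auto simp: assms ac_source ac_var_def\<close>)
    ultimately show "node_val C a (source C) = node_val D a (source D)"
      by simp
  qed
qed

lemma same_function_trans: "same_function C D \<Longrightarrow> same_function D E \<Longrightarrow> same_function C E"
  by (auto simp: same_function_def)

section \<open>Circuits given by a gate function and a root\<close>

text \<open>Keeping only what is reachable from \<open>r\<close> gives every other node a
  predecessor, so that \<open>r\<close> is the only candidate for a source.\<close>

definition rooted :: "(nat \<Rightarrow> gate) \<Rightarrow> nat \<Rightarrow> circuit" where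
  "rooted G r = \<lparr>nodes = {h. (r, h) \<in> {(g, h). h \<in> gate_succs (G g)}\<^sup>*}, gate = G\<rparr>"

text \<open>\<open>N\<close> and \<open>R\<close> bound the reachable part from above: a finite
  closed \<open>N\<close> gives finiteness and the size, and a well-founded \<open>R\<close> along
  which all gates descend gives acyclicity. Acyclicity in turn forbids an edge back to
  \<open>r\<close>.\<close>

lemma
  assumes "finite N" "r \<in> N"
    and closed: "\<And>g. g \<in> N \<Longrightarrow> gate_succs (G g) \<subseteq> N"
    and "wf R" and R: "\<And>g h. \<lbrakk>g \<in> N; h \<in> gate_succs (G g)\<rbrakk> \<Longrightarrow> (h, g) \<in> R"
    and dist: "\<And>g l r. \<lbrakk>g \<in> N; G g = Plus l r \<or> G g = Times l r\<rbrakk> \<Longrightarrow> l \<noteq> r"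
  shows rooted_is_ac: "is_ac (rooted G r)"
    and rooted_source: "source (rooted G r) = r"
    and rooted_nodes: "nodes (rooted G r) \<subseteq> N"
    and rooted_size: "ac_size (rooted G r) \<le> card N"
proof -
  let ?E = "{(g, h). h \<in> gate_succs (G g)}"
  let ?C = "rooted G r"
  have sub: "nodes ?C \<subseteq> N"
  proof
    fix h assume "h \<in> nodes ?C"
    then have "(r, h) \<in> ?E\<^sup>*"
      by (simp add: rooted_def)
    then show "h \<in> N"
      by (induction rule: rtrancl_induct) (use \<open>r \<in> N\<close> closed in auto)
  qed
  then show "nodes ?C \<subseteq> N" .
  show "ac_size ?C \<le> card N"
    unfolding ac_size_def by (rule card_mono) (use sub assms(1) in auto)
  have fin: "finite (nodes ?C)"
    using sub assms(1) finite_subset by blast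
  have E: "edges ?C \<subseteq> nodes ?C \<times> nodes ?C"
    by (auto simp: edges_def rooted_def intro: rtrancl_into_rtrancl)
  have R': "(edges ?C)\<inverse> \<subseteq> R"
    using sub R by (auto simp: edges_def rooted_def)
  then have "wf ((edges ?C)\<inverse>)"
    using \<open>wf R\<close> wf_subset by blast
  then have ac: "acyclic (edges ?C)"
    using wf_acyclic acyclic_converse by blast
  have r: "r \<in> nodes ?C"
    by (simp add: rooted_def)
  have "(h, r) \<notin> edges ?C" for h
  proof
    assume h: "(h, r) \<in> edges ?C"
    then have "(r, h) \<in> ?E\<^sup>*"
      by (simp add: edges_def rooted_def)
    then have "(r, h) \<in> (edges ?C)\<^sup>*"
    proof (induction rule: rtrancl_induct)
      case (step y z)
      then have "(y, z) \<in> edges ?C"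
        by (simp add: edges_def rooted_def)
      then show ?case
        using step.IH by auto
    qed auto
    then have "(r, r) \<in> (edges ?C)\<^sup>+"
      using h by auto
    then show False
      using ac by (auto simp: acyclic_def)
  qed
  then have src: "is_source ?C r"
    using r by (simp add: is_source_def)
  have uniq: "s = r" if "is_source ?C s" for s
  proof (rule ccontr)
    assume "s \<noteq> r"
    have "(r, s) \<in> ?E\<^sup>*"
      using that by (simp add: is_source_def rooted_def)
    then obtain y where "(r, y) \<in> ?E\<^sup>*" "(y, s) \<in> ?E"
      using \<open>s \<noteq> r\<close> by (auto elim: rtranclE)
    then have "(y, s) \<in> edges ?C"
      by (simp add: edges_def rooted_def)
    then show False
      using that by (simp add: is_source_def)
  qed
  show "is_ac ?C"
    unfolding is_ac_def
  proof (intro conjI ballI allI impI)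
    fix g l r' assume "g \<in> nodes ?C" "gate ?C g = Plus l r' \<or> gate ?C g = Times l r'"
    then show "l \<noteq> r'"
      using dist[of g l r'] sub by (auto simp: rooted_def)
  qed (use fin E ac src uniq in auto)
  show "source ?C = r"
    unfolding source_def using src uniq by blast
qed

lemma rooted_gate: "gate (rooted G r) = G"
  by (simp add: rooted_def)

section \<open>Padding\<close>

text \<open>Smoothing inserts factors \<open>BothItem x\<close>, which have value 1; the removal of
  literals inserts the other two kinds.\<close>

datatype item = PosItem nat | NegItem nat | BothItem nat

fun item_var :: "item \<Rightarrow> nat" where
  "item_var (PosItem x) = x"
| "item_var (NegItem x) = x"
| "item_var (BothItem x) = x"

fun item_val :: "(nat \<Rightarrow> real) \<Rightarrow> item \<Rightarrow> real" where
  "item_val a (PosItem x) = a x"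
| "item_val a (NegItem x) = 1 - a x"
| "item_val a (BothItem x) = a x + (1 - a x)"

instance item :: countable
  by countable_datatype

text \<open>
  \<open>Pad is g\<close> names the node that computes the product of the items \<open>is\<close> and of the (transformed)
  node \<open>g\<close> of the original circuit.
\<close>

datatype pad_node = Item item | Pad "item list" nat

instance pad_node :: countable
  by countable_datatype

text \<open>\<open>lf\<close> rewrites the sinks, and \<open>pad g h\<close> lists the factors put
  on the edge from \<open>g\<close> to \<open>h\<close>. Chains with the same remaining factors and
  the same target share their nodes. Successors stay distinct because the two chains below a copied
  gate have different targets, and an item is never a chain.\<close>

fun pad_gate :: "(gate \<Rightarrow> gate) \<Rightarrow> (nat \<Rightarrow> nat \<Rightarrow> item list) \<Rightarrow> circuit \<Rightarrow> pad_node \<Rightarrow> gate" where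
  "pad_gate lf pad C (Item (PosItem x)) = PosLit x"
| "pad_gate lf pad C (Item (NegItem x)) = NegLit x"
| "pad_gate lf pad C (Item (BothItem x)) = Plus (to_nat (Item (PosItem x))) (to_nat (Item (NegItem x)))"
| "pad_gate lf pad C (Pad (i # is) g) = Times (to_nat (Item i)) (to_nat (Pad is g))"
| "pad_gate lf pad C (Pad [] g) = (case gate C g of
      Plus l r \<Rightarrow> Plus (to_nat (Pad (pad g l) l)) (to_nat (Pad (pad g r) r))
    | Times l r \<Rightarrow> Times (to_nat (Pad (pad g l) l)) (to_nat (Pad (pad g r) r))
    | u \<Rightarrow> lf u)"

definition padded :: "(gate \<Rightarrow> gate) \<Rightarrow> (nat \<Rightarrow> nat \<Rightarrow> item list) \<Rightarrow> item list \<Rightarrow> circuit \<Rightarrow> circuit" where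
  "padded lf pad ps C = rooted (pad_gate lf pad C \<circ> from_nat) (to_nat (Pad ps (source C)))"

definition label_vars :: "circuit \<Rightarrow> nat set" where
  "label_vars C = {x. \<exists>g\<in>nodes C. gate C g = PosLit x \<or> gate C g = NegLit x}"

lemma label_vars_bound:
  assumes "is_ac C" shows "finite (label_vars C)" "card (label_vars C) \<le> ac_size C"
proof -
  have "label_vars C \<subseteq> (\<lambda>g. case gate C g of PosLit x \<Rightarrow> x | NegLit x \<Rightarrow> x | _ \<Rightarrow> 0) ` nodes C"
    by (force simp: label_vars_def)
  then show "finite (label_vars C)" "card (label_vars C) \<le> ac_size C"
    using ac_finite[OF assms] unfolding ac_size_def
    by (meson finite_imageI finite_subset, meson card_image_le card_mono finite_imageI le_trans)
qed

lemma node_var_label_vars: "node_var C g \<subseteq> label_vars C"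
  by (auto simp: node_var_def pos_var_def neg_var_def label_vars_def)

fun leaf_val :: "(nat \<Rightarrow> real) \<Rightarrow> gate \<Rightarrow> real" where
  "leaf_val a (Const c) = c"
| "leaf_val a (PosLit x) = a x"
| "leaf_val a (NegLit x) = 1 - a x"
| "leaf_val a _ = 0"

fun leaf_var :: "gate \<Rightarrow> nat set" where
  "leaf_var (PosLit x) = {x}"
| "leaf_var (NegLit x) = {x}"
| "leaf_var _ = {}"

text \<open>Lists no longer than the circuit, over its own variables, keep the size of the padded
  circuit polynomial.\<close>

locale padding =
  fixes C :: circuit and lf :: "gate \<Rightarrow> gate" and pad :: "nat \<Rightarrow> nat \<Rightarrow> item list" and ps :: "item list"
  assumes C: "is_ac C"
    and lf: "\<And>u. gate_succs (lf u) = {}"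
    and pad_len: "\<And>g h. g \<in> nodes C \<Longrightarrow> h \<in> gate_succs (gate C g) \<Longrightarrow>
        length (pad g h) \<le> ac_size C \<and> item_var ` set (pad g h) \<subseteq> label_vars C"
    and ps_len: "length ps \<le> ac_size C" "item_var ` set ps \<subseteq> label_vars C"
begin

abbreviation "C' \<equiv> padded lf pad ps C"

definition items :: "item set" where
  "items = (\<Union>x\<in>label_vars C. {PosItem x, NegItem x, BothItem x})"

lemma in_items: "i \<in> items \<longleftrightarrow> item_var i \<in> label_vars C"
  by (cases i) (auto simp: items_def)

text \<open>A chain consumes its list from the front, so its nodes are the suffixes. They are
  indexed by an edge (or the root) and the number \<open>k\<close> of consumed factors, which gives
  the count.\<close>

definition chains :: "pad_node set" where
  "chains = (\<lambda>((g, h), k). Pad (drop k (pad g h)) h) ` (edges C \<times> {..ac_size C})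
    \<union> (\<lambda>k. Pad (drop k ps) (source C)) ` {..ac_size C}"

text \<open>Edges descend lexicographically: from chains to items, then along the original edges,
  then down the list. The length comes last because it may grow when an original edge is
  followed.\<close>

fun rnk :: "pad_node \<Rightarrow> nat \<times> nat \<times> nat" where
  "rnk (Item (BothItem x)) = (0, 0, 1)"
| "rnk (Item i) = (0, 0, 0)"
| "rnk (Pad is g) = (1, g, length is)"

lemma chains_ConsD: "Pad (i # is) g \<in> chains \<Longrightarrow> Pad is g \<in> chains \<and> i \<in> items"
proof -
  \<comment> \<open>A nonempty suffix has \<open>k < length xs\<close>, so the index
    \<open>Suc k\<close> of its tail still lies in the range up to \<open>n\<close>.\<close>
  have *: "is = drop (Suc k) xs \<and> Suc k \<le> n \<and> i \<in> set xs" if "i # is = drop k xs" "length xs \<le> n" "k \<le> n"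
    for k n and xs :: "item list"
  proof -
    have "k < length xs"
      using that by (metis drop_all leI list.distinct(1))
    moreover have "i \<in> set xs"
      using that by (metis in_set_dropD list.set_intros(1))
    ultimately show ?thesis
      using that by (simp add: drop_Suc) (metis drop_tl list.sel(3))
  qed
  assume "Pad (i # is) g \<in> chains"
  then consider (e) f k where "(f, g) \<in> edges C" "k \<le> ac_size C" "i # is = drop k (pad f g)"
    | (s) k where "g = source C" "k \<le> ac_size C" "i # is = drop k ps"
    by (auto simp: chains_def)
  then show ?thesis
  proof cases
    case e
    then have "is = drop (Suc k) (pad f g) \<and> Suc k \<le> ac_size C \<and> i \<in> set (pad f g)"
      using pad_len[of f g] by (intro *) (auto simp: edges_def)
    then show ?thesis
      using e pad_len[of f g] by (force simp: chains_def in_items edges_def)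
  next
    case s
    then have "is = drop (Suc k) ps \<and> Suc k \<le> ac_size C \<and> i \<in> set ps"
      using ps_len by (intro *) auto
    then show ?thesis
      using s ps_len by (force simp: chains_def in_items)
  qed
qed

lemma chains_node: "Pad is g \<in> chains \<Longrightarrow> g \<in> nodes C"
  using C ac_source(2)[OF C] unfolding is_ac_def by (auto simp: chains_def)

lemma chains_succ:
  assumes "g \<in> nodes C" "h \<in> gate_succs (gate C g)"
  shows "Pad (pad g h) h \<in> chains"
proof -
  have "Pad (pad g h) h = (\<lambda>((g, h), k). Pad (drop k (pad g h)) h) ((g, h), 0)"
    by simp
  then show ?thesis
    using assms unfolding chains_def edges_def by blast
qed

section \<open>Size and acyclicity of padded circuits\<close>

definition all_nodes :: "nat set" where
  "all_nodes = to_nat ` (Item ` items \<union> chains)"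

lemma chains_finite: "finite chains" and chains_card: "card chains \<le> (ac_size C ^ 2 + 1) * (ac_size C + 1)"
proof -
  have E: "edges C \<subseteq> nodes C \<times> nodes C" "finite (nodes C \<times> nodes C)"
    using C by (auto simp: is_ac_def)
  then have fe: "finite (edges C)"
    using finite_subset by blast
  have ce: "card (edges C) \<le> ac_size C ^ 2"
    using card_mono[OF E(2,1)] by (simp add: card_cartesian_product ac_size_def power2_eq_square)
  show "finite chains"
    using fe by (simp add: chains_def)
  have "card ((\<lambda>((g, h), k). Pad (drop k (pad g h)) h) ` (edges C \<times> {..ac_size C})) \<le> card (edges C \<times> {..ac_size C})"
    by (rule card_image_le) (use fe in simp)
  also have "\<dots> \<le> ac_size C ^ 2 * (ac_size C + 1)"
    unfolding card_cartesian_product card_atMost Suc_eq_plus1 using ce by (rule mult_le_mono1)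
  finally have 1: "card ((\<lambda>((g, h), k). Pad (drop k (pad g h)) h) ` (edges C \<times> {..ac_size C}))
      \<le> ac_size C ^ 2 * (ac_size C + 1)" .
  have 2: "card ((\<lambda>k. Pad (drop k ps) (source C)) ` {..ac_size C}) \<le> ac_size C + 1"
    by (metis Suc_eq_plus1 card_atMost card_image_le finite_atMost)
  show "card chains \<le> (ac_size C ^ 2 + 1) * (ac_size C + 1)"
    unfolding chains_def
    by (rule order_trans[OF card_Un_le]) (use 1 2 in \<open>simp add: algebra_simps\<close>)
qed

lemma items_finite: "finite items" and items_card: "card items \<le> 3 * ac_size C"
proof -
  show "finite items"
    using label_vars_bound[OF C] by (simp add: items_def)
  have "card items \<le> (\<Sum>x\<in>label_vars C. card {PosItem x, NegItem x, BothItem x})"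
    unfolding items_def by (rule card_UN_le) (use label_vars_bound[OF C] in simp)
  also have "\<dots> = 3 * card (label_vars C)"
    by simp
  finally show "card items \<le> 3 * ac_size C"
    using label_vars_bound[OF C] by simp
qed

lemma all_nodes_card: "card all_nodes \<le> (ac_size C ^ 2 + 1) * (ac_size C + 1) + 3 * ac_size C"
proof -
  have "card all_nodes \<le> card (Item ` items \<union> chains)"
    unfolding all_nodes_def by (rule card_image_le) (use items_finite chains_finite in simp)
  also have "\<dots> \<le> card (Item ` items) + card chains"
    by (rule card_Un_le)
  also have "card (Item ` items) \<le> card items"
    by (rule card_image_le[OF items_finite])
  finally show ?thesis
    using items_card chains_card by linarith
qed

definition below :: "(nat \<times> nat) set" where
  "below = inv_image (less_than <*lex*> (edges C)\<inverse> <*lex*> less_than) (rnk \<circ> from_nat)"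

lemma padded_ac: "is_ac C'"
  and padded_source: "source C' = to_nat (Pad ps (source C))"
  and padded_nodes: "nodes C' \<subseteq> all_nodes"
  and padded_size: "ac_size C' \<le> (ac_size C ^ 2 + 1) * (ac_size C + 1) + 3 * ac_size C"
proof -
  let ?G = "pad_gate lf pad C \<circ> from_nat" and ?r = "to_nat (Pad ps (source C))"
  have fin: "finite all_nodes"
    using items_finite chains_finite by (simp add: all_nodes_def)
  have "Pad ps (source C) = (\<lambda>k. Pad (drop k ps) (source C)) 0"
    by simp
  then have r: "?r \<in> all_nodes"
    unfolding all_nodes_def chains_def by blast
  have "wf below"
    unfolding below_def by (intro wf_inv_image wf_lex_prod ac_wf[OF C] wf_less_than)
  have step: "m \<in> all_nodes \<and> (m, n) \<in> below" if n: "n \<in> all_nodes" and m: "m \<in> gate_succs (?G n)" for n m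
  proof -
    obtain t where t: "n = to_nat t" "t \<in> Item ` items \<union> chains"
      using n by (auto simp: all_nodes_def)
    consider x where "t = Item (BothItem x)" | x where "t = Item (PosItem x) \<or> t = Item (NegItem x)"
      | i "is" g where "t = Pad (i # is) g" | g where "t = Pad [] g"
      by (metis item.exhaust list.exhaust pad_node.exhaust)
    then show ?thesis
    proof cases
      case 1
      then have "Item (PosItem x) \<in> Item ` items \<union> chains" "Item (NegItem x) \<in> Item ` items \<union> chains"
        using t by (auto simp: in_items chains_def)
      then show ?thesis
        using t m 1 by (auto simp: all_nodes_def below_def)
    next
      case 2
      then show ?thesis
        using t m by auto
    next
      case 3
      then have "Pad is g \<in> chains \<and> i \<in> items"
        using t chains_ConsD by auto
      then show ?thesis
        using t m 3 by (cases i) (auto simp: all_nodes_def below_def)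
    next
      case 4
      then have g: "g \<in> nodes C"
        using t chains_node by auto
      obtain h where "h \<in> gate_succs (gate C g)" "m = to_nat (Pad (pad g h) h)"
        using m 4 t lf by (auto split: gate.splits)
      then show ?thesis
        using t 4 g chains_succ[OF g] by (auto simp: all_nodes_def below_def edges_def)
    qed
  qed
  have dist: "l \<noteq> r" if n: "n \<in> all_nodes" and G: "?G n = Plus l r \<or> ?G n = Times l r" for n l r
  proof -
    obtain t where t: "n = to_nat t" "t \<in> Item ` items \<union> chains"
      using n by (auto simp: all_nodes_def)
    show ?thesis
    proof (cases "(lf, pad, C, t)" rule: pad_gate.cases)
      case (5 lf pad C g)
      then have g: "g \<in> nodes C"
        using t chains_node by auto
      have "lf u \<noteq> Plus l r \<and> lf u \<noteq> Times l r" for u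
        using lf[of u] 5 by auto
      then show ?thesis
        using G t 5 ac_distinct[OF C] g by (auto split: gate.splits)
    qed (use G t in auto)
  qed
  have 1: "gate_succs (?G n) \<subseteq> all_nodes" and 2: "m \<in> gate_succs (?G n) \<Longrightarrow> (m, n) \<in> below"
    if "n \<in> all_nodes" for n m
    using step[OF that] by auto
  note * = fin r 1 \<open>wf below\<close> 2 dist
  show "is_ac C'"
    unfolding padded_def by (rule rooted_is_ac[OF *]) auto
  show "source C' = ?r"
    unfolding padded_def by (rule rooted_source[OF *]) auto
  show "nodes C' \<subseteq> all_nodes"
    unfolding padded_def by (rule rooted_nodes[OF *]) auto
  have "ac_size C' \<le> card all_nodes"
    unfolding padded_def by (rule rooted_size[OF *]) auto
  then show "ac_size C' \<le> (ac_size C ^ 2 + 1) * (ac_size C + 1) + 3 * ac_size C"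
    using all_nodes_card by linarith
qed

lemma padded_gate: "gate C' (to_nat t) = pad_gate lf pad C t"
  by (simp add: padded_def rooted_gate)

lemma padded_node_cases:
  assumes "n \<in> nodes C'"
  obtains i where "n = to_nat (Item i)"
    | i "is" g where "n = to_nat (Pad (i # is) g)" "Pad (i # is) g \<in> chains"
    | g where "n = to_nat (Pad [] g)" "g \<in> nodes C"
proof -
  obtain t where t: "n = to_nat t" "t \<in> Item ` items \<union> chains"
    using assms padded_nodes by (auto simp: all_nodes_def)
  show ?thesis
  proof (cases t)
    case (Item i)
    then show ?thesis
      using t that(1) by blast
  next
    case (Pad "is" g)
    then have "Pad is g \<in> chains"
      using t by auto
    then show ?thesis
      using t that(2,3) Pad chains_node by (cases "is") auto
  qed
qed

lemma padded_PlusE: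
  assumes "n \<in> nodes C'" "gate C' n = Plus l r"
  obtains x where "n = to_nat (Item (BothItem x))" "l = to_nat (Item (PosItem x))" "r = to_nat (Item (NegItem x))"
    | g l0 r0 where "n = to_nat (Pad [] g)" "g \<in> nodes C" "gate C g = Plus l0 r0"
      "l = to_nat (Pad (pad g l0) l0)" "r = to_nat (Pad (pad g r0) r0)"
  using assms(1)
proof (cases rule: padded_node_cases)
  case (1 i)
  then show ?thesis
    using assms that(1) by (cases i) (auto simp: padded_gate)
next
  case (2 i "is" g)
  then show ?thesis
    using assms by (auto simp: padded_gate)
next
  case (3 g)
  have "lf u \<noteq> Plus l r" for u
    using lf[of u] by auto
  then show ?thesis
    using assms 3 that(2) by (auto simp: padded_gate split: gate.splits)
qed

lemma padded_TimesE:
  assumes "n \<in> nodes C'" "gate C' n = Times l r"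
  obtains i "is" g where "n = to_nat (Pad (i # is) g)" "Pad (i # is) g \<in> chains"
      "l = to_nat (Item i)" "r = to_nat (Pad is g)"
    | g l0 r0 where "n = to_nat (Pad [] g)" "g \<in> nodes C" "gate C g = Times l0 r0"
      "l = to_nat (Pad (pad g l0) l0)" "r = to_nat (Pad (pad g r0) r0)"
  using assms(1)
proof (cases rule: padded_node_cases)
  case (1 i)
  then show ?thesis
    using assms by (cases i) (auto simp: padded_gate)
next
  case (2 i "is" g)
  then show ?thesis
    using assms that(1) by (auto simp: padded_gate)
next
  case (3 g)
  have "lf u \<noteq> Times l r" for u
    using lf[of u] by auto
  then show ?thesis
    using assms 3 that(2) by (auto simp: padded_gate split: gate.splits)
qed

section \<open>Values and variables of padded circuits\<close>

definition pad_val :: "(nat \<Rightarrow> real) \<Rightarrow> (nat \<Rightarrow> real) \<Rightarrow> pad_node \<Rightarrow> real" where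
  "pad_val W a t = (case t of Item i \<Rightarrow> item_val a i | Pad is g \<Rightarrow> prod_list (map (item_val a) is) * W g)"

text \<open>\<open>W g\<close> is the intended value of the node for \<open>g\<close> with no
  factors pending. Only its recursion over the original gates has to be checked; items and chains
  satisfy their gate equations by the form of \<open>pad_val\<close>.\<close>

lemma padded_val:
  assumes W: "\<And>g. g \<in> nodes C \<Longrightarrow> W g = (case gate C g of
      Plus l r \<Rightarrow> pad_val W a (Pad (pad g l) l) + pad_val W a (Pad (pad g r) r)
    | Times l r \<Rightarrow> pad_val W a (Pad (pad g l) l) * pad_val W a (Pad (pad g r) r)
    | u \<Rightarrow> leaf_val a (lf u))"
    and "to_nat t \<in> nodes C'"
  shows "node_val C' a (to_nat t) = pad_val W a t"
proof -
  have "node_val C' a (to_nat t) = pad_val W a (from_nat (to_nat t))"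
  proof (rule node_val_unique[OF padded_ac assms(2)])
    fix n assume "n \<in> nodes C'"
    then show "pad_val W a (from_nat n) = (case gate C' n of Const c \<Rightarrow> c | PosLit x \<Rightarrow> a x
      | NegLit x \<Rightarrow> 1 - a x | Plus l r \<Rightarrow> pad_val W a (from_nat l) + pad_val W a (from_nat r)
      | Times l r \<Rightarrow> pad_val W a (from_nat l) * pad_val W a (from_nat r))"
    proof (cases rule: padded_node_cases)
      case (1 i)
      then show ?thesis
        by (cases i) (auto simp: padded_gate pad_val_def)
    next
      case (2 i "is" g)
      then show ?thesis
        by (auto simp: padded_gate pad_val_def)
    next
      case (3 g)
      have "(case lf u of Const c \<Rightarrow> c | PosLit x \<Rightarrow> a x | NegLit x \<Rightarrow> 1 - a x
          | Plus l r \<Rightarrow> X l r | Times l r \<Rightarrow> Y l r) = leaf_val a (lf u)" for u X Y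
        using lf[of u] by (cases "lf u") auto
      then show ?thesis
        using W[OF 3(2)] 3(1) by (cases "gate C g") (simp_all add: padded_gate pad_val_def)
    qed
  qed
  then show ?thesis
    by simp
qed

definition pad_var :: "(nat \<Rightarrow> nat set) \<Rightarrow> pad_node \<Rightarrow> nat set" where
  "pad_var F t = (case t of Item i \<Rightarrow> {item_var i} | Pad is g \<Rightarrow> item_var ` set is \<union> F g)"

lemma padded_var:
  assumes F: "\<And>g. g \<in> nodes C \<Longrightarrow> F g = (case gate C g of
      Plus l r \<Rightarrow> pad_var F (Pad (pad g l) l) \<union> pad_var F (Pad (pad g r) r)
    | Times l r \<Rightarrow> pad_var F (Pad (pad g l) l) \<union> pad_var F (Pad (pad g r) r)
    | u \<Rightarrow> leaf_var (lf u))"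
    and "to_nat t \<in> nodes C'"
  shows "node_var C' (to_nat t) = pad_var F t"
proof -
  have "node_var C' (to_nat t) = pad_var F (from_nat (to_nat t))"
  proof (rule node_var_unique[OF padded_ac assms(2)])
    fix n assume "n \<in> nodes C'"
    then show "pad_var F (from_nat n) = (case gate C' n of Const c \<Rightarrow> {} | PosLit x \<Rightarrow> {x}
      | NegLit x \<Rightarrow> {x} | Plus l r \<Rightarrow> pad_var F (from_nat l) \<union> pad_var F (from_nat r)
      | Times l r \<Rightarrow> pad_var F (from_nat l) \<union> pad_var F (from_nat r))"
    proof (cases rule: padded_node_cases)
      case (1 i)
      then show ?thesis
        by (cases i) (auto simp: padded_gate pad_var_def)
    next
      case (2 i "is" g)
      then show ?thesis
        by (auto simp: padded_gate pad_var_def)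
    next
      case (3 g)
      have "(case lf u of Const c \<Rightarrow> {} | PosLit x \<Rightarrow> {x} | NegLit x \<Rightarrow> {x}
          | Plus l r \<Rightarrow> X l r | Times l r \<Rightarrow> Y l r) = leaf_var (lf u)" for u X Y
        using lf[of u] by (cases "lf u") auto
      then show ?thesis
        using F[OF 3(2)] 3(1) by (cases "gate C g") (simp_all add: padded_gate pad_var_def)
    qed
  qed
  then show ?thesis
    by simp
qed

section \<open>Structural properties of padded circuits\<close>

lemma padded_monotone:
  assumes "\<And>g c. g \<in> nodes C \<Longrightarrow> lf (gate C g) = Const c \<Longrightarrow> c \<ge> 0"
  shows "monotone_ac C'"
  unfolding monotone_ac_def
proof (intro ballI allI impI)
  fix n c assume n: "n \<in> nodes C'" "gate C' n = Const c"
  from n(1) show "c \<ge> 0"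
  proof (cases rule: padded_node_cases)
    case (1 i)
    then show ?thesis
      using n by (cases i) (auto simp: padded_gate)
  next
    case (2 i "is" g)
    then show ?thesis
      using n by (auto simp: padded_gate)
  next
    case (3 g)
    then show ?thesis
      using n assms by (auto simp: padded_gate split: gate.splits)
  qed
qed

end

context padding
begin

text \<open>Each product in a chain splits off one variable, which by \<open>edge\<close> and
  \<open>root\<close> occurs neither in the remaining items nor in the target. These conditions pass
  to suffixes.\<close>

lemma padded_decomposable:
  assumes var: "\<And>t. to_nat t \<in> nodes C' \<Longrightarrow> node_var C' (to_nat t) = pad_var F t"
    and edge: "\<And>g h. g \<in> nodes C \<Longrightarrow> h \<in> gate_succs (gate C g) \<Longrightarrow>
        distinct (map item_var (pad g h)) \<and> item_var ` set (pad g h) \<inter> F h = {}"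
    and root: "distinct (map item_var ps)" "item_var ` set ps \<inter> F (source C) = {}"
    and times: "\<And>g l r. g \<in> nodes C \<Longrightarrow> gate C g = Times l r \<Longrightarrow>
        pad_var F (Pad (pad g l) l) \<inter> pad_var F (Pad (pad g r) r) = {}"
  shows "decomposable C'"
  unfolding decomposable_def
proof (intro ballI allI impI)
  have chain: "distinct (map item_var is) \<and> item_var ` set is \<inter> F g = {}" if in_chain: "Pad is g \<in> chains" for "is" g
  proof -
    have *: "distinct (map item_var (drop k xs)) \<and> item_var ` set (drop k xs) \<inter> F g = {}"
      if "distinct (map item_var xs) \<and> item_var ` set xs \<inter> F g = {}" for k xs
    proof
      show "distinct (map item_var (drop k xs))"
        using that distinct_drop[of "map item_var xs" k] by (simp add: drop_map)
      show "item_var ` set (drop k xs) \<inter> F g = {}"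
        using that set_drop_subset[of k xs] by blast
    qed
    from in_chain consider (e) f k where "f \<in> nodes C" "g \<in> gate_succs (gate C f)" "is = drop k (pad f g)"
      | (s) k where "g = source C" "is = drop k ps"
      by (auto simp: chains_def edges_def)
    then show ?thesis
      using *[OF edge] *[of ps] root by cases auto
  qed
  fix n l r
  assume n: "n \<in> nodes C'" "gate C' n = Times l r"
  have lr: "l \<in> nodes C'" "r \<in> nodes C'"
    using ac_succ[OF padded_ac n(1)] n(2) by auto
  show "node_var C' l \<inter> node_var C' r = {}"
    using n
  proof (cases rule: padded_TimesE)
    case (1 i "is" g)
    then show ?thesis
      using lr chain[OF 1(2)] by (auto simp: var pad_var_def)
  next
    case (2 g l0 r0)
    then show ?thesis
      using lr times by (auto simp: var)
  qed
qed

lemma padded_smooth: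
  assumes var: "\<And>t. to_nat t \<in> nodes C' \<Longrightarrow> node_var C' (to_nat t) = pad_var F t"
    and plus: "\<And>g l r. g \<in> nodes C \<Longrightarrow> gate C g = Plus l r \<Longrightarrow>
        pad_var F (Pad (pad g l) l) = pad_var F (Pad (pad g r) r)"
  shows "smooth C'"
  unfolding smooth_def
proof (intro ballI allI impI)
  fix n l r
  assume n: "n \<in> nodes C'" "gate C' n = Plus l r"
  have lr: "l \<in> nodes C'" "r \<in> nodes C'"
    using ac_succ[OF padded_ac n(1)] n(2) by auto
  show "node_var C' l = node_var C' r"
    using n
  proof (cases rule: padded_PlusE)
    case (1 x)
    then show ?thesis
      using lr by (auto simp: var pad_var_def)
  next
    case (2 g l0 r0)
    then show ?thesis
      using lr plus by (auto simp: var)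
  qed
qed

lemma padded_deterministic:
  assumes val: "\<And>t a. \<forall>x. a x \<in> {0, 1} \<Longrightarrow> to_nat t \<in> nodes C' \<Longrightarrow> node_val C' a (to_nat t) = pad_val (W a) a t"
    and plus: "\<And>g l r a. g \<in> nodes C \<Longrightarrow> gate C g = Plus l r \<Longrightarrow> \<forall>x. a x \<in> {0, 1} \<Longrightarrow>
        pad_val (W a) a (Pad (pad g l) l) = 0 \<or> pad_val (W a) a (Pad (pad g r) r) = 0"
  shows "deterministic C'"
  unfolding deterministic_iff[OF padded_ac]
proof (intro ballI allI impI)
  fix n l r and a :: "nat \<Rightarrow> real"
  assume n: "n \<in> nodes C'" "gate C' n = Plus l r" and a: "\<forall>x. a x \<in> {0, 1}"
  have lr: "l \<in> nodes C'" "r \<in> nodes C'"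
    using ac_succ[OF padded_ac n(1)] n(2) by auto
  show "node_val C' a l = 0 \<or> node_val C' a r = 0"
    using n
  proof (cases rule: padded_PlusE)
    \<comment> \<open>The sum is x + (1 - x), whose summands are never both nonzero on 0/1
      inputs.\<close>
    case (1 x)
    then show ?thesis
      using lr a by (auto simp: val pad_val_def)
  next
    case (2 g l0 r0)
    then show ?thesis
      using lr plus a by (auto simp: val)
  qed
qed

lemma root_in: "to_nat (Pad ps (source C)) \<in> nodes C'"
  using ac_source(2)[OF padded_ac] padded_source by simp

lemma padded_same_function:
  assumes var: "\<And>t. to_nat t \<in> nodes C' \<Longrightarrow> node_var C' (to_nat t) = pad_var F t"
    and val: "\<And>t a. \<forall>x. a x \<in> {0, 1} \<Longrightarrow> to_nat t \<in> nodes C' \<Longrightarrow> node_val C' a (to_nat t) = pad_val (W a) a t"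
    and "pad_var F (Pad ps (source C)) = node_var C (source C)"
    and "\<And>a. \<forall>x. a x \<in> {0, 1} \<Longrightarrow> pad_val (W a) a (Pad ps (source C)) = node_val C a (source C)"
  shows "same_function C' C"
  using assms root_in unfolding same_function_iff[OF padded_ac C] ac_var_def padded_source by simp

end

lemma node_var_succ:
  assumes "is_ac C" "g \<in> nodes C" "h \<in> gate_succs (gate C g)"
  shows "node_var C h \<subseteq> node_var C g" "pos_var C h \<subseteq> pos_var C g" "neg_var C h \<subseteq> neg_var C g"
  using assms(3) node_var_gate[OF assms(1,2)] pos_var_gate[OF assms(1,2)] neg_var_gate[OF assms(1,2)]
  by (auto split: gate.splits)

lemma node_var_finite: "is_ac C \<Longrightarrow> finite (node_var C g)"
  by (rule finite_subset[OF node_var_label_vars label_vars_bound(1)])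

lemma node_var_subset_card: 
  assumes "is_ac C" "X \<subseteq> node_var C g"
  shows "card X \<le> ac_size C" "X \<subseteq> label_vars C" "finite X"
proof -
  show X: "X \<subseteq> label_vars C"
    using assms(2) node_var_label_vars by blast
  then show "card X \<le> ac_size C" "finite X"
    using label_vars_bound[OF assms(1)] card_mono[OF label_vars_bound(1)[OF assms(1)] X]
    by (auto intro: finite_subset)
qed

section \<open>Smoothing\<close>

definition gap :: "circuit \<Rightarrow> nat \<Rightarrow> nat \<Rightarrow> item list" where
  "gap C g h = (case gate C g of
     Plus l r \<Rightarrow> map BothItem (sorted_list_of_set (node_var C g - node_var C h)) | _ \<Rightarrow> [])"

text \<open>The padding locale demands a sink for every gate, so internal gates need some value too;
  \<open>Const 0\<close> is arbitrary.\<close>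

definition keep_leaf :: "gate \<Rightarrow> gate" where
  "keep_leaf u = (if gate_succs u = {} then u else Const 0)"

text \<open>The inserted factors have value 1 and repeat variables that the sum already has, so the
  original nodes keep their values and variables. Determinism is therefore inherited. So is
  decomposability: products are not padded, and a chain avoids the variables of its target.\<close>

lemma smoothing:
  assumes C: "is_ac C"
  obtains C' where "is_ac C'" "same_function C' C" "smooth C'"
    "ac_size C' \<le> (ac_size C ^ 2 + 1) * (ac_size C + 1) + 3 * ac_size C"
    "monotone_ac C \<Longrightarrow> monotone_ac C'" "decomposable C \<Longrightarrow> decomposable C'"
    "deterministic C \<Longrightarrow> deterministic C'"
proof -
  have gap_len: "length (gap C g h) \<le> ac_size C" and gap_vars: "item_var ` set (gap C g h) \<subseteq> node_var C g - node_var C h" for g h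
  proof -
    have "node_var C g - node_var C h \<subseteq> node_var C g"
      by blast
    from node_var_subset_card[OF C this]
    show "length (gap C g h) \<le> ac_size C" "item_var ` set (gap C g h) \<subseteq> node_var C g - node_var C h"
      by (auto simp: gap_def split: gate.split)
  qed
  interpret padding C keep_leaf "gap C" "[]"
    using C gap_len gap_vars node_var_label_vars
    by unfold_locales (auto simp: keep_leaf_def, blast)
  have prod: "prod_list (map (item_val a) (gap C g h)) = 1" for a g h
    by (auto simp: gap_def comp_def map_replicate_const split: gate.split)
  have gap_Plus: "item_var ` set (gap C g h) = node_var C g - node_var C h" if "gate C g = Plus l r" for g h l r
    using that node_var_finite[OF C] by (auto simp: gap_def image_image)
  have gap_Times: "gap C g h = []" if "gate C g = Times l r" for g h l r
    using that by (simp add: gap_def)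
  have val: "node_val C' a (to_nat t) = pad_val (node_val C a) a t" if "to_nat t \<in> nodes C'" for t a
  proof (rule padded_val[OF _ that])
    fix g assume "g \<in> nodes C"
    from node_val_gate[OF C this]
    show "node_val C a g = (case gate C g of
      Plus l r \<Rightarrow> pad_val (node_val C a) a (Pad (gap C g l) l) + pad_val (node_val C a) a (Pad (gap C g r) r)
    | Times l r \<Rightarrow> pad_val (node_val C a) a (Pad (gap C g l) l) * pad_val (node_val C a) a (Pad (gap C g r) r)
    | u \<Rightarrow> leaf_val a (keep_leaf u))"
      by (cases "gate C g") (simp_all add: pad_val_def prod keep_leaf_def)
  qed
  have sub: "node_var C l \<subseteq> node_var C g" "node_var C r \<subseteq> node_var C g"
    if "g \<in> nodes C" "gate C g = Plus l r" for g l r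
    using node_var_gate[OF C that(1)] that(2) by auto
  have var: "node_var C' (to_nat t) = pad_var (node_var C) t" if "to_nat t \<in> nodes C'" for t
  proof (rule padded_var[OF _ that])
    fix g assume g: "g \<in> nodes C"
    from node_var_gate[OF C this] sub[OF g]
    show "node_var C g = (case gate C g of
      Plus l r \<Rightarrow> pad_var (node_var C) (Pad (gap C g l) l) \<union> pad_var (node_var C) (Pad (gap C g r) r)
    | Times l r \<Rightarrow> pad_var (node_var C) (Pad (gap C g l) l) \<union> pad_var (node_var C) (Pad (gap C g r) r)
    | u \<Rightarrow> leaf_var (keep_leaf u))"
      by (cases "gate C g") (auto simp add: pad_var_def gap_Plus gap_Times keep_leaf_def)
  qed
  show ?thesis
  proof (rule that[of C'])
    show "is_ac C'"
      by (rule padded_ac)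
    show "same_function C' C"
      by (rule padded_same_function[OF var val]) (auto simp: pad_var_def pad_val_def)
    show "smooth C'"
    proof (rule padded_smooth[OF var])
      fix g l r
      assume g: "g \<in> nodes C" "gate C g = Plus l r"
      show "pad_var (node_var C) (Pad (gap C g l) l) = pad_var (node_var C) (Pad (gap C g r) r)"
        using sub[OF g] g(2) by (auto simp: pad_var_def gap_Plus)
    qed
    show "ac_size C' \<le> (ac_size C ^ 2 + 1) * (ac_size C + 1) + 3 * ac_size C"
      by (rule padded_size)
    show "monotone_ac C'" if "monotone_ac C"
      by (rule padded_monotone) (use that in \<open>auto simp: monotone_ac_def keep_leaf_def split: if_splits\<close>)
    show "decomposable C'" if "decomposable C"
    proof (rule padded_decomposable[OF var])
      fix g h
      show "distinct (map item_var (gap C g h)) \<and> item_var ` set (gap C g h) \<inter> node_var C h = {}"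
      proof
        show "distinct (map item_var (gap C g h))"
          by (auto simp: gap_def comp_def split: gate.split)
      qed (use gap_vars[of g h] in blast)
    next
      fix g l r
      assume "g \<in> nodes C" "gate C g = Times l r"
      then show "pad_var (node_var C) (Pad (gap C g l) l) \<inter> pad_var (node_var C) (Pad (gap C g r) r) = {}"
        using that by (simp add: pad_var_def gap_Times decomposable_def)
    qed auto
    show "deterministic C'" if "deterministic C"
      by (rule padded_deterministic[OF val])
        (use that in \<open>auto simp: pad_val_def prod deterministic_iff[OF C]\<close>)
  qed
qed

section \<open>Removing literals of unique polarity\<close>

definition pure_pos :: "circuit \<Rightarrow> nat \<Rightarrow> nat set" where
  "pure_pos C g = pos_var C g - neg_var C g"

definition pure_neg :: "circuit \<Rightarrow> nat \<Rightarrow> nat set" where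
  "pure_neg C g = neg_var C g - pos_var C g"

definition mixed :: "circuit \<Rightarrow> nat \<Rightarrow> nat set" where
  "mixed C g = pos_var C g \<inter> neg_var C g"

text \<open>Every pure literal is made true, whatever its polarity; as a factor it then
  disappears.\<close>

definition force :: "circuit \<Rightarrow> (nat \<Rightarrow> real) \<Rightarrow> nat \<Rightarrow> nat \<Rightarrow> real" where
  "force C a g x = (if x \<in> pure_pos C g then 1 else if x \<in> pure_neg C g then 0 else a x)"

definition literals :: "nat set \<Rightarrow> nat set \<Rightarrow> item list" where
  "literals P N = map PosItem (sorted_list_of_set P) @ map NegItem (sorted_list_of_set N)"

lemma literals:
  assumes "finite P" "finite N" "P \<inter> N = {}"
  shows "item_var ` set (literals P N) = P \<union> N" "distinct (map item_var (literals P N))"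
    "length (literals P N) = card (P \<union> N)"
    "prod_list (map (item_val a) (literals P N)) = (\<Prod>x\<in>P. a x) * (\<Prod>x\<in>N. 1 - a x)"
  using assms prod.distinct_set_conv_list[of "sorted_list_of_set P" a]
    prod.distinct_set_conv_list[of "sorted_list_of_set N" "\<lambda>x. 1 - a x"]
  by (auto simp: literals_def image_Un image_image comp_def card_Un_disjoint)

lemma literals_val:
  assumes "finite P" "finite N" "P \<inter> N = {}" "\<forall>x. a x \<in> {0, 1::real}"
  shows "prod_list (map (item_val a) (literals P N)) = (if (\<forall>x\<in>P. a x = 1) \<and> (\<forall>x\<in>N. a x = 0) then 1 else 0)"
proof -
  have "(\<Prod>x\<in>P. a x) = (if \<forall>x\<in>P. a x = 1 then 1 else 0)"
    using assms(1,4) by (auto intro: prod.neutral)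
  moreover have "(\<Prod>x\<in>N. 1 - a x) = (if \<forall>x\<in>N. a x = 0 then 1 else 0)"
    using assms(2,4) by (auto intro: prod.neutral)
  ultimately show ?thesis
    by (simp add: literals assms)
qed

text \<open>By smoothness, every term of the polynomial computed at a node contains all of its variables.\<close>

lemma pure_zero:
  assumes C: "is_ac C" "smooth C" and "g \<in> nodes C"
    and "x \<in> pure_pos C g \<and> a x = 0 \<or> x \<in> pure_neg C g \<and> a x = 1"
  shows "node_val C a g = 0"
  using C(1) assms(3,4)
proof (induction rule: ac_induct)
  case (node g)
  have *: "node_val C a h = 0" if "h \<in> gate_succs (gate C g)" "x \<in> node_var C h" for h
  proof (rule node.IH[OF that(1)])
    show "x \<in> pure_pos C h \<and> a x = 0 \<or> x \<in> pure_neg C h \<and> a x = 1"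
      using node.prems that node_var_succ[OF C(1) node(1) that(1)]
      by (auto simp: pure_pos_def pure_neg_def node_var_def)
  qed
  have x: "x \<in> node_var C g"
    using node.prems by (auto simp: pure_pos_def pure_neg_def node_var_def)
  show ?case
  proof (cases "gate C g")
    case (Plus l r)
    then have "x \<in> node_var C l" "x \<in> node_var C r"
      using x C(2) node(1) node_var_gate[OF C(1) node(1)] by (auto simp: smooth_def)
    then show ?thesis
      using * Plus by (simp add: node_val_gate[OF C(1) node(1)])
  next
    case (Times l r)
    then have "x \<in> node_var C l \<or> x \<in> node_var C r"
      using x node_var_gate[OF C(1) node(1)] by auto
    then show ?thesis
      using * Times by (auto simp: node_val_gate[OF C(1) node(1)])
  qed (use node.prems pos_var_gate[OF C(1) node(1)] neg_var_gate[OF C(1) node(1)] in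
      \<open>auto simp: node_val_gate[OF C(1) node(1)] pure_pos_def pure_neg_def\<close>)
qed

text \<open>The new node for \<open>g\<close> computes \<open>W a g\<close>, the value of
  \<open>g\<close> with its pure literals made true, and reads exactly \<open>mixed C g\<close>. A
  literal that is pure at \<open>h\<close> but mixed at its parent \<open>g\<close> becomes a factor
  on that edge. By weak decomposability the operands of a product share no variable that is mixed
  there, and this is decomposability of the result.\<close>

lemma pure_literal_removal:
  assumes C: "is_ac C" and sm: "smooth C" and wd: "weakly_decomposable C"
  obtains C' where "is_ac C'" "same_function C' C" "smooth C'"
    "ac_size C' \<le> (ac_size C ^ 2 + 1) * (ac_size C + 1) + 3 * ac_size C"
    "monotone_ac C \<Longrightarrow> monotone_ac C'" "decomposable C'"
    "deterministic C \<Longrightarrow> deterministic C'"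
proof -
  define pad where "pad g h = literals (pure_pos C h - pure_pos C g) (pure_neg C h - pure_neg C g)" for g h
  define ps where "ps = literals (pure_pos C (source C)) (pure_neg C (source C))"
  \<comment> \<open>At a literal the variable is pure, so its forced value turns the literal into
    1.\<close>
  define lf :: "gate \<Rightarrow> gate" where
    "lf u = (case u of Const c \<Rightarrow> u | _ \<Rightarrow> Const 1)" for u
  have fin: "finite (pure_pos C g)" "finite (pure_neg C g)" for g
    using node_var_finite[OF C, of g] by (auto simp: pure_pos_def pure_neg_def node_var_def)
  have disj: "P \<inter> N = {}" if "P \<subseteq> pure_pos C g" "N \<subseteq> pure_neg C g" for P N g
    using that by (auto simp: pure_pos_def pure_neg_def)
  have sub: "P \<union> N \<subseteq> node_var C g" if "P \<subseteq> pure_pos C g" "N \<subseteq> pure_neg C g" for P N g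
    using that by (auto simp: pure_pos_def pure_neg_def node_var_def)
  have lits: "item_var ` set (literals P N) = P \<union> N" "distinct (map item_var (literals P N))"
    "length (literals P N) \<le> ac_size C" "P \<union> N \<subseteq> label_vars C" "finite P" "finite N" "P \<inter> N = {}"
    if "P \<subseteq> pure_pos C g" "N \<subseteq> pure_neg C g" for P N g
  proof -
    show f: "finite P" "finite N"
      using fin that finite_subset by blast+
    show "P \<inter> N = {}"
      using disj that by blast
    from literals[OF f this] node_var_subset_card[OF C sub[OF that]]
    show "item_var ` set (literals P N) = P \<union> N" "distinct (map item_var (literals P N))"
      "length (literals P N) \<le> ac_size C" "P \<union> N \<subseteq> label_vars C"
      by auto
  qed
  have pad: "item_var ` set (pad g h) = (pure_pos C h - pure_pos C g) \<union> (pure_neg C h - pure_neg C g)"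
    "distinct (map item_var (pad g h))" "length (pad g h) \<le> ac_size C" "item_var ` set (pad g h) \<subseteq> label_vars C" for g h
    using lits[of "pure_pos C h - pure_pos C g" h "pure_neg C h - pure_neg C g"] unfolding pad_def by auto
  have ps: "item_var ` set ps = pure_pos C (source C) \<union> pure_neg C (source C)"
    "distinct (map item_var ps)" "length ps \<le> ac_size C" "item_var ` set ps \<subseteq> label_vars C"
    using lits[of "pure_pos C (source C)" "source C" "pure_neg C (source C)"] unfolding ps_def by auto
  interpret padding C lf pad ps
    by unfold_locales (use C pad ps in \<open>auto simp: lf_def split: gate.split\<close>)
  define W where "W a g = node_val C (force C a g) g" for a g
  have force: "force C a g x \<in> {0, 1}" if "\<forall>x. a x \<in> {0, 1}" for a g x
    using that[rule_format, of x] by (auto simp: force_def)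
  \<comment> \<open>The factors are the indicator of the literals that are pure at \<open>h\<close>
    but not at \<open>g\<close>. If all of them hold, the two forced assignments agree on
    \<open>node_var C h\<close>. Otherwise \<open>force C a g\<close> violates a pure literal of
    \<open>h\<close>, and \<open>pure_zero\<close> makes both sides 0.\<close>
  have edge_val: "pad_val (W a) a (Pad (pad g h) h) = node_val C (force C a g) h"
    if g: "g \<in> nodes C" "h \<in> gate_succs (gate C g)" and a: "\<forall>x. a x \<in> {0, 1}" for a g h
  proof -
    let ?P = "pure_pos C h - pure_pos C g" and ?N = "pure_neg C h - pure_neg C g"
    have h: "h \<in> nodes C"
      using ac_succ[OF C g] .
    have polarity: "pos_var C h \<subseteq> pos_var C g" "neg_var C h \<subseteq> neg_var C g"
      using node_var_succ[OF C g] by auto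
    have prod: "prod_list (map (item_val a) (pad g h)) = (if (\<forall>x\<in>?P. a x = 1) \<and> (\<forall>x\<in>?N. a x = 0) then 1 else 0)"
      unfolding pad_def using lits[of ?P h ?N] by (intro literals_val) (use a in auto)
    show ?thesis
    proof (cases "(\<forall>x\<in>?P. a x = 1) \<and> (\<forall>x\<in>?N. a x = 0)")
      case True
      have "node_val C (force C a h) h = node_val C (force C a g) h"
        by (rule node_val_cong[OF C h])
          (use True polarity in \<open>auto simp: force_def node_var_def pure_pos_def pure_neg_def\<close>)
      then show ?thesis
        using prod True by (simp add: pad_val_def W_def)
    next
      case False
      then obtain x where "x \<in> ?P \<and> a x = 0 \<or> x \<in> ?N \<and> a x = 1"
        using a by auto
      then have "x \<in> pure_pos C h \<and> force C a g x = 0 \<or> x \<in> pure_neg C h \<and> force C a g x = 1"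
        using polarity by (auto simp: force_def pure_pos_def pure_neg_def)
      then have "node_val C (force C a g) h = 0"
        by (rule pure_zero[OF C sm h])
      then show ?thesis
        using prod False by (simp add: pad_val_def)
    qed
  qed
  \<comment> \<open>A variable of \<open>h\<close> that is mixed at \<open>g\<close> is either mixed
    at \<open>h\<close> already or belongs to one of the factors.\<close>
  have edge_var: "pad_var (mixed C) (Pad (pad g h) h) = mixed C g \<inter> node_var C h"
    if g: "g \<in> nodes C" "h \<in> gate_succs (gate C g)" for g h
    using node_var_succ[OF C g] by (auto simp: pad_var_def pad mixed_def pure_pos_def pure_neg_def node_var_def)
  have val: "node_val C' a (to_nat t) = pad_val (W a) a t" if a: "\<forall>x. a x \<in> {0, 1}" and "to_nat t \<in> nodes C'" for t a
  proof (rule padded_val[OF _ that(2)])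
    fix g assume g: "g \<in> nodes C"
    have 1: "pos_var C g = {x} \<Longrightarrow> neg_var C g = {} \<Longrightarrow> force C a g x = 1"
      and 2: "pos_var C g = {} \<Longrightarrow> neg_var C g = {x} \<Longrightarrow> force C a g x = 0" for x
      by (auto simp: force_def pure_pos_def pure_neg_def)
    show "W a g = (case gate C g of
      Plus l r \<Rightarrow> pad_val (W a) a (Pad (pad g l) l) + pad_val (W a) a (Pad (pad g r) r)
    | Times l r \<Rightarrow> pad_val (W a) a (Pad (pad g l) l) * pad_val (W a) a (Pad (pad g r) r)
    | u \<Rightarrow> leaf_val a (lf u))"
      using edge_val[OF g _ a] 1 2 node_val_gate[OF C g, of "force C a g"] pos_var_gate[OF C g] neg_var_gate[OF C g]
      by (cases "gate C g") (simp_all add: W_def lf_def)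
  qed
  have var: "node_var C' (to_nat t) = pad_var (mixed C) t" if "to_nat t \<in> nodes C'" for t
  proof (rule padded_var[OF _ that])
    fix g assume g: "g \<in> nodes C"
    have "mixed C g \<subseteq> node_var C g"
      by (auto simp: mixed_def node_var_def)
    then show "mixed C g = (case gate C g of
      Plus l r \<Rightarrow> pad_var (mixed C) (Pad (pad g l) l) \<union> pad_var (mixed C) (Pad (pad g r) r)
    | Times l r \<Rightarrow> pad_var (mixed C) (Pad (pad g l) l) \<union> pad_var (mixed C) (Pad (pad g r) r)
    | u \<Rightarrow> leaf_var (lf u))"
      using edge_var[OF g] node_var_gate[OF C g] pos_var_gate[OF C g] neg_var_gate[OF C g]
      by (cases "gate C g") (auto simp: mixed_def lf_def)
  qed
  show ?thesis
  proof (rule that[of C'])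
    let ?s = "source C"
    show "is_ac C'"
      by (rule padded_ac)
    show "same_function C' C"
    proof (rule padded_same_function[OF var val])
      show "pad_var (mixed C) (Pad ps ?s) = node_var C ?s"
        by (auto simp: pad_var_def ps mixed_def pure_pos_def pure_neg_def node_var_def)
      fix a :: "nat \<Rightarrow> real" assume a: "\<forall>x. a x \<in> {0, 1}"
      have prod: "prod_list (map (item_val a) ps)
          = (if (\<forall>x\<in>pure_pos C ?s. a x = 1) \<and> (\<forall>x\<in>pure_neg C ?s. a x = 0) then 1 else 0)"
        unfolding ps_def using lits[of "pure_pos C ?s" ?s "pure_neg C ?s"] by (intro literals_val) (use a in auto)
      show "pad_val (W a) a (Pad ps ?s) = node_val C a ?s"
      proof (cases "(\<forall>x\<in>pure_pos C ?s. a x = 1) \<and> (\<forall>x\<in>pure_neg C ?s. a x = 0)")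
        case True
        then have "force C a ?s = a"
          by (auto simp: force_def)
        then show ?thesis
          using prod True by (simp add: pad_val_def W_def)
      next
        case False
        then obtain x where "x \<in> pure_pos C ?s \<and> a x = 0 \<or> x \<in> pure_neg C ?s \<and> a x = 1"
          using a by auto
        then have "node_val C a ?s = 0"
          by (rule pure_zero[OF C sm ac_source(2)[OF C]])
        then show ?thesis
          using prod False by (simp add: pad_val_def)
      qed
    qed
    show "smooth C'"
    proof (rule padded_smooth[OF var])
      fix g l r
      assume g: "g \<in> nodes C" "gate C g = Plus l r"
      then have "node_var C l = node_var C r"
        using sm by (simp add: smooth_def)
      then show "pad_var (mixed C) (Pad (pad g l) l) = pad_var (mixed C) (Pad (pad g r) r)"
        using edge_var[OF g(1)] g(2) by simp
    qed
    show "ac_size C' \<le> (ac_size C ^ 2 + 1) * (ac_size C + 1) + 3 * ac_size C"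
      by (rule padded_size)
    show "monotone_ac C'" if "monotone_ac C"
    proof (rule padded_monotone)
      fix g c
      assume "g \<in> nodes C" "lf (gate C g) = Const c"
      then show "c \<ge> 0"
        using that by (cases "gate C g") (auto simp: lf_def monotone_ac_def)
    qed
    show "decomposable C'"
    proof (rule padded_decomposable[OF var])
      fix g h
      show "distinct (map item_var (pad g h)) \<and> item_var ` set (pad g h) \<inter> mixed C h = {}"
        by (auto simp: pad mixed_def pure_pos_def pure_neg_def)
    next
      fix g l r
      assume g: "g \<in> nodes C" "gate C g = Times l r"
      then have "mixed C g \<inter> (node_var C l \<inter> node_var C r) = {}"
        using wd unfolding weakly_decomposable_def mixed_def by blast
      then show "pad_var (mixed C) (Pad (pad g l) l) \<inter> pad_var (mixed C) (Pad (pad g r) r) = {}"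
        using edge_var[OF g(1)] g(2) by auto
    qed (use ps in \<open>auto simp: mixed_def pure_pos_def pure_neg_def\<close>)
    show "deterministic C'" if "deterministic C"
    proof (rule padded_deterministic[OF val])
      fix g l r and a :: "nat \<Rightarrow> real"
      assume g: "g \<in> nodes C" "gate C g = Plus l r" and a: "\<forall>x. a x \<in> {0, 1}"
      \<comment> \<open>Both padded operands are values under the same 0/1 assignment
        \<open>force C a g\<close>, to which determinism of \<open>C\<close> applies.\<close>
      have "node_val C (force C a g) l = 0 \<or> node_val C (force C a g) r = 0"
        using that g force[OF a] unfolding deterministic_iff[OF C] by blast
      then show "pad_val (W a) a (Pad (pad g l) l) = 0 \<or> pad_val (W a) a (Pad (pad g r) r) = 0"
        using edge_val[OF g(1) _ a] g(2) by auto
    qed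
  qed
qed

section \<open>Succinctness\<close>

text \<open>Size bounds may have negative coefficients. Taking absolute values gives a larger
  polynomial that is monotone on nonnegative arguments, so that bounds can be composed.\<close>

definition abs_poly :: "real poly \<Rightarrow> real poly" where
  "abs_poly p = map_poly abs p"

lemma poly_abs_poly: "poly (abs_poly p) x = (\<Sum>i\<le>degree p. \<bar>coeff p i\<bar> * x ^ i)"
proof -
  have "degree (abs_poly p) \<le> degree p"
    by (simp add: abs_poly_def degree_map_poly)
  then have "poly (abs_poly p) x = (\<Sum>i\<le>degree p. coeff (abs_poly p) i * x ^ i)"
    unfolding poly_altdef by (intro sum.mono_neutral_left) (auto simp: coeff_eq_0)
  then show ?thesis
    by (simp add: abs_poly_def coeff_map_poly)
qed

lemma poly_le_abs_poly: "x \<ge> 0 \<Longrightarrow> poly p x \<le> poly (abs_poly p) (x :: real)"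
  unfolding poly_abs_poly poly_altdef[of p]
  by (intro sum_mono mult_right_mono) auto

lemma abs_poly_mono: "0 \<le> x \<Longrightarrow> x \<le> y \<Longrightarrow> poly (abs_poly p) x \<le> poly (abs_poly p) (y :: real)"
  unfolding poly_abs_poly by (intro sum_mono mult_left_mono power_mono) auto

lemma succ_le_trans [trans]:
  assumes "K1 \<le>\<^sub>s K2" "K2 \<le>\<^sub>s K3"
  shows "K1 \<le>\<^sub>s K3"
proof -
  obtain p q :: "real poly" where
    p: "\<forall>D\<in>K2. \<exists>C\<in>K1. same_function C D \<and> real (ac_size C) \<le> poly p (real (ac_size D))" and
    q: "\<forall>D\<in>K3. \<exists>C\<in>K2. same_function C D \<and> real (ac_size C) \<le> poly q (real (ac_size D))"
    using assms unfolding succ_le_def by blast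
  have "\<exists>C\<in>K1. same_function C E \<and> real (ac_size C) \<le> poly (pcompose (abs_poly p) q) (real (ac_size E))" if "E \<in> K3" for E
  proof -
    obtain D where D: "D \<in> K2" "same_function D E" "real (ac_size D) \<le> poly q (real (ac_size E))"
      using q \<open>E \<in> K3\<close> by blast
    obtain C where C: "C \<in> K1" "same_function C D" "real (ac_size C) \<le> poly p (real (ac_size D))"
      using p D(1) by blast
    note C(3)
    also have "poly p (real (ac_size D)) \<le> poly (abs_poly p) (real (ac_size D))"
      by (simp add: poly_le_abs_poly)
    also have "\<dots> \<le> poly (abs_poly p) (poly q (real (ac_size E)))"
      using D(3) by (intro abs_poly_mono) auto
    finally show ?thesis
      using C(1,2) D(2) same_function_trans by (auto simp: poly_pcompose)
  qed
  then show ?thesis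
    unfolding succ_le_def by blast
qed

lemma succ_le_superset: "K2 \<subseteq> K1 \<Longrightarrow> K1 \<le>\<^sub>s K2"
  unfolding succ_le_def by (intro exI[of _ "[:0, 1:]"]) (auto simp: same_function_def)

lemma succ_le_cubic:
  assumes "\<And>D. D \<in> K2 \<Longrightarrow> \<exists>C\<in>K1. same_function C D \<and>
      ac_size C \<le> (ac_size D ^ 2 + 1) * (ac_size D + 1) + 3 * ac_size D"
  shows "K1 \<le>\<^sub>s K2"
  unfolding succ_le_def
proof (intro exI ballI)
  fix D assume "D \<in> K2"
  then obtain C where C: "C \<in> K1" "same_function C D"
    "ac_size C \<le> (ac_size D ^ 2 + 1) * (ac_size D + 1) + 3 * ac_size D"
    using assms by blast
  have "real (ac_size C) \<le> real ((ac_size D ^ 2 + 1) * (ac_size D + 1) + 3 * ac_size D)"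
    using C(3) of_nat_le_iff by blast
  \<comment> \<open>With s for the size, (s^2 + 1)(s + 1) + 3s = s^3 + s^2 + 4s + 1; coefficients
    are listed from the constant term.\<close>
  also have "\<dots> = poly [:1, 4, 1, 1:] (real (ac_size D))"
    by (simp add: algebra_simps power2_eq_square)
  finally show "\<exists>C\<in>K1. same_function C D \<and> real (ac_size C) \<le> poly [:1, 4, 1, 1:] (real (ac_size D))"
    using C by blast
qed

lemma decomposable_imp_weakly_decomposable: "decomposable C \<Longrightarrow> weakly_decomposable C"
  unfolding decomposable_def weakly_decomposable_def by blast

lemmas class_defs = ACm_def D_ACm_def sD_ACm_def dD_ACm_def sdD_ACm_def wD_ACm_def swD_ACm_def
  dwD_ACm_def sdwD_ACm_def

section \<open>Polynomial simulations and class inclusions\<close>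

lemma sD_le_D: "sD_ACm \<le>\<^sub>s D_ACm"
proof (rule succ_le_cubic)
  fix D assume D: "D \<in> D_ACm"
  then have "is_ac D"
    by (simp add: class_defs)
  then show "\<exists>C\<in>sD_ACm. same_function C D \<and>
      ac_size C \<le> (ac_size D ^ 2 + 1) * (ac_size D + 1) + 3 * ac_size D"
    by (rule smoothing) (use D in \<open>auto simp: class_defs\<close>)
qed

lemma sdD_le_dD: "sdD_ACm \<le>\<^sub>s dD_ACm"
proof (rule succ_le_cubic)
  fix D assume D: "D \<in> dD_ACm"
  then have "is_ac D"
    by (simp add: class_defs)
  then show "\<exists>C\<in>sdD_ACm. same_function C D \<and>
      ac_size C \<le> (ac_size D ^ 2 + 1) * (ac_size D + 1) + 3 * ac_size D"
    by (rule smoothing) (use D in \<open>auto simp: class_defs\<close>)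
qed

lemma sD_le_swD: "sD_ACm \<le>\<^sub>s swD_ACm"
proof (rule succ_le_cubic)
  fix D assume D: "D \<in> swD_ACm"
  then have "is_ac D" "smooth D" "weakly_decomposable D"
    by (simp_all add: class_defs)
  then show "\<exists>C\<in>sD_ACm. same_function C D \<and>
      ac_size C \<le> (ac_size D ^ 2 + 1) * (ac_size D + 1) + 3 * ac_size D"
    by (rule pure_literal_removal) (use D in \<open>auto simp: class_defs\<close>)
qed

lemma sdD_le_sdwD: "sdD_ACm \<le>\<^sub>s sdwD_ACm"
proof (rule succ_le_cubic)
  fix D assume D: "D \<in> sdwD_ACm"
  then have "is_ac D" "smooth D" "weakly_decomposable D"
    by (simp_all add: class_defs)
  then show "\<exists>C\<in>sdD_ACm. same_function C D \<and>
      ac_size C \<le> (ac_size D ^ 2 + 1) * (ac_size D + 1) + 3 * ac_size D"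
    by (rule pure_literal_removal) (use D in \<open>auto simp: class_defs\<close>)
qed

lemma class_inclusions:
  "D_ACm \<subseteq> wD_ACm" "swD_ACm \<subseteq> wD_ACm" "dwD_ACm \<subseteq> wD_ACm" "sD_ACm \<subseteq> D_ACm" "sD_ACm \<subseteq> swD_ACm"
  "dD_ACm \<subseteq> D_ACm" "sdD_ACm \<subseteq> sD_ACm" "sdwD_ACm \<subseteq> swD_ACm" "dD_ACm \<subseteq> dwD_ACm" "sdwD_ACm \<subseteq> dwD_ACm"
  "sdD_ACm \<subseteq> dD_ACm" "sdD_ACm \<subseteq> sdwD_ACm"
  using decomposable_imp_weakly_decomposable by (auto simp: class_defs)

section \<open>Refuting succinctness by exponential lower bounds\<close>

lemma poly_less_exponential:
  fixes p :: "real poly" and c :: real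
  assumes "c > 1"
  shows "\<exists>k\<ge>1. poly p (real k) < c ^ k"
proof -
  have ln: "ln c > 0"
    using assms by simp
  have pow: "(\<lambda>k. real k ^ i / c ^ k) \<longlonglongrightarrow> 0" for i
  proof -
    \<comment> \<open>As x^i / exp x tends to 0, the substitution x = k ln c turns exp x into
      c^k.\<close>
    have "filterlim (\<lambda>k. real k * ln c) at_top sequentially"
      using ln filterlim_at_top_mult_tendsto_pos[OF tendsto_const ln filterlim_real_sequentially]
      by (simp add: mult.commute)
    then have "(\<lambda>k. (real k * ln c) ^ i / exp (real k * ln c)) \<longlonglongrightarrow> 0"
      by (rule filterlim_compose[OF tendsto_power_div_exp_0])
    then have "(\<lambda>k. (real k * ln c) ^ i / exp (real k * ln c) * (1 / ln c ^ i)) \<longlonglongrightarrow> 0"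
      by (rule tendsto_mult_left_zero)
    moreover have "exp (real k * ln c) = c ^ k" for k
      using assms by (simp add: exp_of_nat_mult)
    ultimately show ?thesis
      using ln by (simp add: power_mult_distrib field_simps)
  qed
  have "(\<lambda>k. \<Sum>i\<le>degree p. coeff p i * (real k ^ i / c ^ k)) \<longlonglongrightarrow> 0"
    by (intro tendsto_null_sum tendsto_mult_right_zero pow)
  then have "\<forall>\<^sub>F k in sequentially. (\<Sum>i\<le>degree p. coeff p i * (real k ^ i / c ^ k)) < 1"
    by (rule order_tendstoD) simp
  then have "\<forall>\<^sub>F k in sequentially. k \<ge> 1 \<and> (\<Sum>i\<le>degree p. coeff p i * (real k ^ i / c ^ k)) < 1"
    using eventually_ge_at_top[of "1::nat"] by eventually_elim simp
  then obtain k where "k \<ge> 1" "(\<Sum>i\<le>degree p. coeff p i * (real k ^ i / c ^ k)) < 1"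
    by (auto dest: eventually_happens)
  moreover have "(\<Sum>i\<le>degree p. coeff p i * (real k ^ i / c ^ k)) = poly p (real k) / c ^ k"
    by (simp add: poly_altdef sum_divide_distrib)
  ultimately show ?thesis
    using assms by (auto simp: divide_less_eq)
qed

lemma not_succ_leI:
  fixes c :: real
  assumes "c > 1"
    and D: "\<And>k. k \<ge> 1 \<Longrightarrow> D k \<in> K2" "\<And>k. k \<ge> 1 \<Longrightarrow> real (ac_size (D k)) \<le> poly q (real k)"
    and lower: "\<And>k C. k \<ge> 1 \<Longrightarrow> C \<in> K1 \<Longrightarrow> same_function C (D k) \<Longrightarrow> c ^ k \<le> real (ac_size C)"
  shows "\<not> K1 \<le>\<^sub>s K2"
proof
  assume "K1 \<le>\<^sub>s K2"
  then obtain p where p: "\<forall>D\<in>K2. \<exists>C\<in>K1. same_function C D \<and> real (ac_size C) \<le> poly p (real (ac_size D))"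
    unfolding succ_le_def by blast
  obtain k where k: "k \<ge> 1" "poly (pcompose (abs_poly p) q) (real k) < c ^ k"
    using poly_less_exponential[OF \<open>c > 1\<close>] by blast
  obtain C where C: "C \<in> K1" "same_function C (D k)" "real (ac_size C) \<le> poly p (real (ac_size (D k)))"
    using p D(1)[OF k(1)] by blast
  have "c ^ k \<le> real (ac_size C)"
    using lower k(1) C(1,2) by blast
  also note C(3)
  also have "poly p (real (ac_size (D k))) \<le> poly (abs_poly p) (real (ac_size (D k)))"
    by (simp add: poly_le_abs_poly)
  also have "\<dots> \<le> poly (abs_poly p) (poly q (real k))"
    using D(2)[OF k(1)] by (intro abs_poly_mono) auto
  finally show False
    using k(2) by (simp add: poly_pcompose)
qed

section \<open>Circuits of formulas\<close>

datatype formula = FConst real | FPos nat | FNeg nat | FPlus formula formula | FTimes formula formula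

text \<open>The position of a subformula in this list names its node.\<close>

fun subs :: "formula \<Rightarrow> formula list" where
  "subs (FPlus e f) = FPlus e f # subs e @ subs f"
| "subs (FTimes e f) = FTimes e f # subs e @ subs f"
| "subs e = [e]"

fun fval :: "(nat \<Rightarrow> real) \<Rightarrow> formula \<Rightarrow> real" where
  "fval a (FConst c) = c"
| "fval a (FPos x) = a x"
| "fval a (FNeg x) = 1 - a x"
| "fval a (FPlus e f) = fval a e + fval a f"
| "fval a (FTimes e f) = fval a e * fval a f"

fun fpos :: "formula \<Rightarrow> nat set" where
  "fpos (FPos x) = {x}"
| "fpos (FPlus e f) = fpos e \<union> fpos f"
| "fpos (FTimes e f) = fpos e \<union> fpos f"
| "fpos _ = {}"

fun fneg :: "formula \<Rightarrow> nat set" where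
  "fneg (FNeg x) = {x}"
| "fneg (FPlus e f) = fneg e \<union> fneg f"
| "fneg (FTimes e f) = fneg e \<union> fneg f"
| "fneg _ = {}"

text \<open>The list is in preorder: the first child follows its parent, and the second follows the
  whole list of the first. Naming nodes by position keeps equal subformulas apart, as the two
  successors of a gate must differ.\<close>

definition formula_gate :: "formula \<Rightarrow> nat \<Rightarrow> gate" where
  "formula_gate e i = (case subs e ! i of FConst c \<Rightarrow> Const c | FPos x \<Rightarrow> PosLit x | FNeg x \<Rightarrow> NegLit x
    | FPlus f g \<Rightarrow> Plus (Suc i) (Suc i + length (subs f))
    | FTimes f g \<Rightarrow> Times (Suc i) (Suc i + length (subs f)))"

definition formula_ac :: "formula \<Rightarrow> circuit" where
  "formula_ac e = rooted (formula_gate e) 0"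

lemma subs_0: "subs e ! 0 = e" and subs_pos: "0 < length (subs e)"
  by (cases e; simp)+

lemma subs_children:
  assumes "i < length (subs e)" "subs e ! i = FPlus f g \<or> subs e ! i = FTimes f g"
  shows "Suc i + length (subs f) < length (subs e) \<and> subs e ! Suc i = f \<and> subs e ! (Suc i + length (subs f)) = g"
  using assms
proof (induction e arbitrary: i)
  case (FPlus e1 e2)
  show ?case
  proof (cases i)
    case 0
    then show ?thesis
      using FPlus.prems subs_0 subs_pos by (auto simp: nth_append)
  next
    case (Suc j)
    show ?thesis
    proof (cases "j < length (subs e1)")
      case True
      then show ?thesis
        using FPlus.IH(1)[of j] FPlus.prems Suc by (auto simp: nth_append)
    next
      case False
      then obtain m where "j = length (subs e1) + m"
        using le_Suc_ex not_less by blast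
      then show ?thesis
        using FPlus.IH(2)[of m] FPlus.prems Suc by (auto simp: nth_append)
    qed
  qed
next
  case (FTimes e1 e2)
  show ?case
  proof (cases i)
    case 0
    then show ?thesis
      using FTimes.prems subs_0 subs_pos by (auto simp: nth_append)
  next
    case (Suc j)
    show ?thesis
    proof (cases "j < length (subs e1)")
      case True
      then show ?thesis
        using FTimes.IH(1)[of j] FTimes.prems Suc by (auto simp: nth_append)
    next
      case False
      then obtain m where "j = length (subs e1) + m"
        using le_Suc_ex not_less by blast
      then show ?thesis
        using FTimes.IH(2)[of m] FTimes.prems Suc by (auto simp: nth_append)
    qed
  qed
qed auto

lemma formula_ac: "is_ac (formula_ac e)"
  and formula_source: "source (formula_ac e) = 0"
  and formula_nodes: "nodes (formula_ac e) \<subseteq> {..<length (subs e)}"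
  and formula_size: "ac_size (formula_ac e) \<le> length (subs e)"
proof -
  let ?N = "{..<length (subs e)}"
  have 0: "0 \<in> ?N"
    using subs_pos by simp
  \<comment> \<open>Children stand later in the preorder, so the distance to the end of the list
    decreases along edges.\<close>
  have 1: "gate_succs (formula_gate e i) \<subseteq> ?N" "h \<in> gate_succs (formula_gate e i) \<Longrightarrow> (h, i) \<in> measure (\<lambda>i. length (subs e) - i)"
    "formula_gate e i = Plus l r \<or> formula_gate e i = Times l r \<Longrightarrow> l \<noteq> r" if "i \<in> ?N" for i h l r
  proof -
    have *: "subs e ! i = FPlus f g \<or> subs e ! i = FTimes f g \<Longrightarrow> Suc i + length (subs f) < length (subs e)" for f g
      using subs_children[of i e f g] that by auto
    show "gate_succs (formula_gate e i) \<subseteq> ?N" "h \<in> gate_succs (formula_gate e i) \<Longrightarrow> (h, i) \<in> measure (\<lambda>i. length (subs e) - i)"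
      using * unfolding formula_gate_def by (fastforce split: formula.splits)+
    show "formula_gate e i = Plus l r \<or> formula_gate e i = Times l r \<Longrightarrow> l \<noteq> r"
      using subs_pos by (auto simp: formula_gate_def split: formula.splits)
  qed
  note * = finite_lessThan 0 1(1) wf_measure 1(2,3)
  show "is_ac (formula_ac e)"
    unfolding formula_ac_def by (rule rooted_is_ac[OF *]) auto
  show "source (formula_ac e) = 0"
    unfolding formula_ac_def by (rule rooted_source[OF *]) auto
  show "nodes (formula_ac e) \<subseteq> ?N"
    unfolding formula_ac_def by (rule rooted_nodes[OF *]) auto
  have "ac_size (formula_ac e) \<le> card ?N"
    unfolding formula_ac_def by (rule rooted_size[OF *]) auto
  then show "ac_size (formula_ac e) \<le> length (subs e)"
    by simp
qed

lemma formula_gate: "gate (formula_ac e) = formula_gate e"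
  by (simp add: formula_ac_def rooted_gate)

lemma formula_node_length: "i \<in> nodes (formula_ac e) \<Longrightarrow> i < length (subs e)"
  using formula_nodes by auto

lemma formula_node_val:
  assumes "i \<in> nodes (formula_ac e)"
  shows "node_val (formula_ac e) a i = fval a (subs e ! i)"
proof (rule node_val_unique[OF formula_ac assms])
  fix i assume "i \<in> nodes (formula_ac e)"
  from subs_children[OF formula_node_length[OF this]]
  show "fval a (subs e ! i) = (case gate (formula_ac e) i of Const c \<Rightarrow> c | PosLit x \<Rightarrow> a x | NegLit x \<Rightarrow> 1 - a x
      | Plus l r \<Rightarrow> fval a (subs e ! l) + fval a (subs e ! r) | Times l r \<Rightarrow> fval a (subs e ! l) * fval a (subs e ! r))"
    by (cases "subs e ! i") (auto simp: formula_gate formula_gate_def)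
qed

lemma formula_pos_var:
  assumes "i \<in> nodes (formula_ac e)"
  shows "pos_var (formula_ac e) i = fpos (subs e ! i)"
proof (rule pos_var_unique[OF formula_ac assms])
  fix i assume "i \<in> nodes (formula_ac e)"
  from subs_children[OF formula_node_length[OF this]]
  show "fpos (subs e ! i) = (case gate (formula_ac e) i of Const c \<Rightarrow> {} | PosLit x \<Rightarrow> {x} | NegLit x \<Rightarrow> {}
      | Plus l r \<Rightarrow> fpos (subs e ! l) \<union> fpos (subs e ! r) | Times l r \<Rightarrow> fpos (subs e ! l) \<union> fpos (subs e ! r))"
    by (cases "subs e ! i") (auto simp: formula_gate formula_gate_def)
qed

lemma formula_neg_var:
  assumes "i \<in> nodes (formula_ac e)"
  shows "neg_var (formula_ac e) i = fneg (subs e ! i)"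
proof (rule neg_var_unique[OF formula_ac assms])
  fix i assume "i \<in> nodes (formula_ac e)"
  from subs_children[OF formula_node_length[OF this]]
  show "fneg (subs e ! i) = (case gate (formula_ac e) i of Const c \<Rightarrow> {} | PosLit x \<Rightarrow> {} | NegLit x \<Rightarrow> {x}
      | Plus l r \<Rightarrow> fneg (subs e ! l) \<union> fneg (subs e ! r) | Times l r \<Rightarrow> fneg (subs e ! l) \<union> fneg (subs e ! r))"
    by (cases "subs e ! i") (auto simp: formula_gate formula_gate_def)
qed

lemma formula_node_var:
  "i \<in> nodes (formula_ac e) \<Longrightarrow> node_var (formula_ac e) i = fpos (subs e ! i) \<union> fneg (subs e ! i)"
  by (simp add: node_var_def formula_pos_var formula_neg_var)

lemma formula_ac_val: "node_val (formula_ac e) a (source (formula_ac e)) = fval a e"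
  using formula_node_val[OF ac_source(2)[OF formula_ac]] by (simp add: formula_source subs_0)

lemma formula_ac_var: "ac_var (formula_ac e) = fpos e \<union> fneg e"
  using formula_node_var[OF ac_source(2)[OF formula_ac]] by (simp add: ac_var_def formula_source subs_0)

lemma formula_gateE:
  assumes i: "i \<in> nodes (formula_ac e)"
  shows "gate (formula_ac e) i = Plus l r \<Longrightarrow> l \<in> nodes (formula_ac e) \<and> r \<in> nodes (formula_ac e) \<and>
      FPlus (subs e ! l) (subs e ! r) = subs e ! i \<and> subs e ! i \<in> set (subs e)"
    and "gate (formula_ac e) i = Times l r \<Longrightarrow> l \<in> nodes (formula_ac e) \<and> r \<in> nodes (formula_ac e) \<and>
      FTimes (subs e ! l) (subs e ! r) = subs e ! i \<and> subs e ! i \<in> set (subs e)"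
    and "gate (formula_ac e) i = Const c \<Longrightarrow> FConst c = subs e ! i \<and> subs e ! i \<in> set (subs e)"
proof -
  have mem: "subs e ! i \<in> set (subs e)"
    using formula_node_length[OF i] by simp
  have succ: "l \<in> nodes (formula_ac e) \<and> r \<in> nodes (formula_ac e)"
    if "gate (formula_ac e) i = Plus l r \<or> gate (formula_ac e) i = Times l r" for l r
    using ac_succ[OF formula_ac i] that by auto
  note ch = subs_children[OF formula_node_length[OF i]]
  show "l \<in> nodes (formula_ac e) \<and> r \<in> nodes (formula_ac e) \<and>
      FPlus (subs e ! l) (subs e ! r) = subs e ! i \<and> subs e ! i \<in> set (subs e)"
    if G: "gate (formula_ac e) i = Plus l r"
  proof -
    from G obtain f g where "subs e ! i = FPlus f g" "l = Suc i" "r = Suc i + length (subs f)"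
      by (auto simp: formula_gate formula_gate_def split: formula.splits)
    then show ?thesis
      using ch[of f g] mem succ G by simp
  qed
  show "l \<in> nodes (formula_ac e) \<and> r \<in> nodes (formula_ac e) \<and>
      FTimes (subs e ! l) (subs e ! r) = subs e ! i \<and> subs e ! i \<in> set (subs e)"
    if G: "gate (formula_ac e) i = Times l r"
  proof -
    from G obtain f g where "subs e ! i = FTimes f g" "l = Suc i" "r = Suc i + length (subs f)"
      by (auto simp: formula_gate formula_gate_def split: formula.splits)
    then show ?thesis
      using ch[of f g] mem succ G by simp
  qed
  show "FConst c = subs e ! i \<and> subs e ! i \<in> set (subs e)" if "gate (formula_ac e) i = Const c"
    using that mem by (auto simp: formula_gate formula_gate_def split: formula.splits)
qed

section \<open>Structural criteria for formulas\<close>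

lemma formula_monotone:
  assumes "\<And>c. FConst c \<in> set (subs e) \<Longrightarrow> c \<ge> 0"
  shows "monotone_ac (formula_ac e)"
  unfolding monotone_ac_def
proof (intro ballI allI impI)
  fix i c
  assume "i \<in> nodes (formula_ac e)" "gate (formula_ac e) i = Const c"
  from formula_gateE(3)[OF this] show "c \<ge> 0"
    using assms[of c] by simp
qed

lemma formula_decomposable:
  assumes "\<And>f g. FTimes f g \<in> set (subs e) \<Longrightarrow> (fpos f \<union> fneg f) \<inter> (fpos g \<union> fneg g) = {}"
  shows "decomposable (formula_ac e)"
  unfolding decomposable_def
proof (intro ballI allI impI)
  fix i l r
  assume "i \<in> nodes (formula_ac e)" "gate (formula_ac e) i = Times l r"
  from formula_gateE(2)[OF this] show "node_var (formula_ac e) l \<inter> node_var (formula_ac e) r = {}"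
    using assms[of "subs e ! l" "subs e ! r"] by (simp add: formula_node_var)
qed

lemma formula_weakly_decomposable:
  assumes "\<And>f g. FTimes f g \<in> set (subs e) \<Longrightarrow>
    (fpos f \<union> fneg f) \<inter> (fpos g \<union> fneg g) \<inter> (fpos f \<union> fpos g) \<inter> (fneg f \<union> fneg g) = {}"
  shows "weakly_decomposable (formula_ac e)"
  unfolding weakly_decomposable_def
proof (intro ballI allI impI)
  fix i l r x
  assume i: "i \<in> nodes (formula_ac e)" "gate (formula_ac e) i = Times l r"
    and x: "x \<in> node_var (formula_ac e) l \<inter> node_var (formula_ac e) r"
  have s: "subs e ! i = FTimes (subs e ! l) (subs e ! r)" "FTimes (subs e ! l) (subs e ! r) \<in> set (subs e)"
    "l \<in> nodes (formula_ac e)" "r \<in> nodes (formula_ac e)"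
    using formula_gateE(2)[OF i] by simp_all
  show "\<not> (x \<in> pos_var (formula_ac e) i \<and> x \<in> neg_var (formula_ac e) i)"
    using assms[OF s(2)] x s by (auto simp: formula_node_var formula_pos_var[OF i(1)] formula_neg_var[OF i(1)])
qed

lemma formula_deterministic:
  assumes "\<And>f g a. FPlus f g \<in> set (subs e) \<Longrightarrow> \<forall>x. a x \<in> {0, 1} \<Longrightarrow> fval a f = 0 \<or> fval a g = 0"
  shows "deterministic (formula_ac e)"
  unfolding deterministic_iff[OF formula_ac]
proof (intro ballI allI impI)
  fix i l r and a :: "nat \<Rightarrow> real"
  assume "i \<in> nodes (formula_ac e)" "gate (formula_ac e) i = Plus l r" and a: "\<forall>x. a x \<in> {0, 1}"
  from formula_gateE(1)[OF this(1,2)] show "node_val (formula_ac e) a l = 0 \<or> node_val (formula_ac e) a r = 0"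
    using assms[of "subs e ! l" "subs e ! r" a] a by (simp add: formula_node_val)
qed

section \<open>Deterministic circuits take few multiplicatively independent values\<close>

text \<open>Nodes that are not constants get the neutral factor 1, so products can range over all
  nodes.\<close>

definition const_of :: "circuit \<Rightarrow> nat \<Rightarrow> real" where
  "const_of C h = (case gate C h of Const c \<Rightarrow> c | _ \<Rightarrow> 1)"

text \<open>A nonzero literal is 1, a nonzero sum equals its only nonzero summand, and a product
  adds exponents. Sharing can make the exponents exponentially large, so none of the later arguments
  bounds them.\<close>

lemma deterministic_monomial:
  assumes C: "is_ac C" "deterministic C" and a: "\<forall>x. a x \<in> {0, 1}"
    and "g \<in> nodes C" "node_val C a g \<noteq> 0"
  shows "\<exists>e :: nat \<Rightarrow> nat. node_val C a g = (\<Prod>h\<in>nodes C. const_of C h ^ e h)"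
  using C(1) assms(4,5)
proof (induction rule: ac_induct)
  case (node g)
  have one: "\<exists>e :: nat \<Rightarrow> nat. 1 = (\<Prod>h\<in>nodes C. const_of C h ^ e h)"
    by (rule exI[of _ "\<lambda>_. 0"]) simp
  note val = node_val_gate[OF C(1) node(1), of a]
  show ?case
  proof (cases "gate C g")
    case (Const c)
    have "(\<Prod>h\<in>nodes C. const_of C h ^ of_bool (h = g)) = (\<Prod>h\<in>{g}. const_of C h ^ of_bool (h = g))"
      by (rule prod.mono_neutral_right) (use node(1) ac_finite[OF C(1)] in auto)
    then have "node_val C a g = (\<Prod>h\<in>nodes C. const_of C h ^ of_bool (h = g))"
      using Const by (simp add: val const_of_def)
    then show ?thesis
      by (rule exI[of _ "\<lambda>h. of_bool (h = g)"])
  next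
    case (PosLit x)
    then show ?thesis
      using node.prems a[rule_format, of x] one by (auto simp: val)
  next
    case (NegLit x)
    then show ?thesis
      using node.prems a[rule_format, of x] one by (auto simp: val)
  next
    case (Plus l r)
    then have "node_val C a l = 0 \<or> node_val C a r = 0"
      using C(2) node(1) a unfolding deterministic_iff[OF C(1)] by blast
    then show ?thesis
      using node.prems node.IH Plus by (auto simp: val)
  next
    case (Times l r)
    then have "node_val C a l \<noteq> 0" "node_val C a r \<noteq> 0"
      using node.prems by (auto simp: val)
    then obtain e f :: "nat \<Rightarrow> nat" where
      "node_val C a l = (\<Prod>h\<in>nodes C. const_of C h ^ e h)"
      "node_val C a r = (\<Prod>h\<in>nodes C. const_of C h ^ f h)"
      using node.IH[of l] node.IH[of r] Times by auto
    then have "node_val C a g = (\<Prod>h\<in>nodes C. const_of C h ^ (e h + f h))"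
      using Times by (simp add: val power_add prod.distrib)
    then show ?thesis
      by (rule exI[of _ "\<lambda>h. e h + f h"])
  qed
qed

text \<open>A pigeonhole argument in the style of Siegel's lemma: the exponents of the
  \<open>c h\<close> depend linearly on \<open>y\<close>, and with more unknowns than equations two
  vectors have the same image. Two natural vectors in place of one integer relation avoid division
  by a \<open>c h\<close> that may be 0.\<close>

lemma multiplicative_dependence:
  fixes v :: "'i \<Rightarrow> real" and c :: "'h \<Rightarrow> real" and e :: "'i \<Rightarrow> 'h \<Rightarrow> nat"
  assumes fin: "finite H" "finite I" and less: "card H < card I"
    and v: "\<And>i. i \<in> I \<Longrightarrow> v i = (\<Prod>h\<in>H. c h ^ e i h)"
  shows "\<exists>y\<in>I \<rightarrow>\<^sub>E UNIV. \<exists>z\<in>I \<rightarrow>\<^sub>E UNIV. y \<noteq> z \<and> (\<Prod>i\<in>I. v i ^ y i) = (\<Prod>i\<in>I. v i ^ z i :: real)"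
proof -
  \<comment> \<open>\<open>M\<close> exceeds the sum of all entries of \<open>e\<close>, so vectors
    below \<open>B\<close> have images below \<open>M * B\<close>. As \<open>B > M ^ card H\<close>,
    these number fewer than \<open>B ^ Suc (card H)\<close>, which is at most the number of
    vectors.\<close>
  define M where "M = (\<Sum>i\<in>I. \<Sum>h\<in>H. e i h) + 1"
  define B where "B = M ^ card H + 1"
  define \<phi> where "\<phi> y = (\<lambda>h\<in>H. \<Sum>i\<in>I. y i * e i h)" for y :: "'i \<Rightarrow> nat"
  let ?Y = "I \<rightarrow>\<^sub>E {..<B}"
  have "\<phi> ` ?Y \<subseteq> H \<rightarrow>\<^sub>E {..<M * B}"
  proof
    fix w assume "w \<in> \<phi> ` ?Y"
    then obtain y where y: "y \<in> ?Y" "w = \<phi> y"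
      by blast
    have "(\<Sum>i\<in>I. y i * e i h) < M * B" if h: "h \<in> H" for h
    proof -
      have "(\<Sum>i\<in>I. y i * e i h) \<le> (\<Sum>i\<in>I. B * (\<Sum>h\<in>H. e i h))"
        using y(1) h fin(1) by (intro sum_mono mult_le_mono member_le_sum) (auto simp: PiE_iff less_imp_le)
      also have "\<dots> = B * (M - 1)"
        by (simp add: M_def sum_distrib_left)
      also have "\<dots> < M * B"
        by (simp add: M_def B_def)
      finally show ?thesis .
    qed
    then show "w \<in> H \<rightarrow>\<^sub>E {..<M * B}"
      using y(2) by (auto simp: \<phi>_def)
  qed
  then have "card (\<phi> ` ?Y) \<le> card (H \<rightarrow>\<^sub>E {..<M * B})"
    by (intro card_mono finite_PiE fin) auto
  also have "\<dots> = M ^ card H * B ^ card H"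
    by (simp add: card_PiE fin power_mult_distrib)
  also have "\<dots> < B * B ^ card H"
    by (simp add: B_def)
  also have "\<dots> = B ^ Suc (card H)"
    by simp
  also have "\<dots> \<le> B ^ card I"
    using less by (intro power_increasing) (auto simp: B_def)
  also have "\<dots> = card ?Y"
    by (simp add: card_PiE fin)
  finally have "\<not> inj_on \<phi> ?Y"
    using pigeonhole by blast
  then obtain y z where yz: "y \<in> ?Y" "z \<in> ?Y" "y \<noteq> z" "\<phi> y = \<phi> z"
    by (auto simp: inj_on_def)
  have prod: "(\<Prod>i\<in>I. v i ^ u i) = (\<Prod>h\<in>H. c h ^ (\<Sum>i\<in>I. u i * e i h))" for u
  proof -
    have "(\<Prod>i\<in>I. v i ^ u i) = (\<Prod>i\<in>I. \<Prod>h\<in>H. c h ^ (u i * e i h))"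
      by (rule prod.cong) (simp_all add: v prod_power_distrib mult.commute flip: power_mult)
    also have "\<dots> = (\<Prod>h\<in>H. \<Prod>i\<in>I. c h ^ (u i * e i h))"
      by (rule prod.swap)
    finally show ?thesis
      by (simp add: power_sum)
  qed
  have "(\<Sum>i\<in>I. y i * e i h) = (\<Sum>i\<in>I. z i * e i h)" if "h \<in> H" for h
    using fun_cong[OF yz(4), of h] that by (simp add: \<phi>_def)
  then have "(\<Prod>i\<in>I. v i ^ y i) = (\<Prod>i\<in>I. v i ^ z i)"
    unfolding prod by simp
  then show ?thesis
    using yz by (intro bexI[of _ y] bexI[of _ z]) auto
qed

text \<open>Only the factor for \<open>j\<close> vanishes at \<open>- real j\<close>, so the
  exponents can be read off the polynomial, and different vectors give different
  polynomials.\<close>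

lemma order_prod_linear:
  fixes J :: "nat set" and y :: "nat \<Rightarrow> nat"
  assumes "finite J" "j \<in> J"
  shows "order (- real j) (\<Prod>i\<in>J. [:real i, 1:] ^ y i) = y j"
proof -
  let ?Q = "\<Prod>i\<in>J - {j}. [:real i, 1:] ^ y i"
  have "poly ?Q (- real j) \<noteq> 0"
    using assms by (auto simp: poly_prod)
  then have "order (- real j) ?Q = 0" "?Q \<noteq> 0"
    by (auto intro: order_0I)
  moreover have "order (- real j) ([:real j, 1:] ^ y j) = y j"
    using order_power_n_n[of "- real j" "y j"] by simp
  ultimately have "order (- real j) ([:real j, 1:] ^ y j * ?Q) = y j"
    by (subst order_mult) auto
  then show ?thesis
    using prod.remove[OF assms, of "\<lambda>i. [:real i, 1:] ^ y i"] by simp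
qed

text \<open>Each pair of different exponent vectors excludes the finitely many roots of a nonzero
  polynomial in t. Extensional vectors on a finite set are countable, while an open interval is
  not.\<close>

lemma exists_independent_shift:
  fixes J :: "nat set"
  assumes "finite J"
  shows "\<exists>t>0. \<forall>y\<in>J \<rightarrow>\<^sub>E UNIV. \<forall>z\<in>J \<rightarrow>\<^sub>E UNIV.
    (\<Prod>j\<in>J. (t + real j) ^ y j) = (\<Prod>j\<in>J. (t + real j) ^ z j) \<longrightarrow> y = (z :: nat \<Rightarrow> nat)"
proof -
  let ?Y = "J \<rightarrow>\<^sub>E (UNIV :: nat set)"
  define P where "P y = (\<Prod>j\<in>J. [:real j, 1:] ^ y j)" for y :: "nat \<Rightarrow> nat"
  define bad where "bad = (\<Union>(y, z) \<in> {(y, z) \<in> ?Y \<times> ?Y. y \<noteq> z}. {t. poly (P y - P z) t = 0})"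
  have neq: "P y \<noteq> P z" if "y \<in> ?Y" "z \<in> ?Y" "y \<noteq> z" for y z
  proof
    assume "P y = P z"
    then have "y j = z j" if "j \<in> J" for j
      using order_prod_linear[OF assms that] unfolding P_def by metis
    then show False
      using that by (metis PiE_ext)
  qed
  have "countable bad"
    unfolding bad_def
  proof (rule countable_UN)
    have "countable (?Y \<times> ?Y)"
      using assms by (intro countable_SIGMA countable_PiE) auto
    then show "countable {(y, z) \<in> ?Y \<times> ?Y. y \<noteq> z}"
      by (rule countable_subset[rotated]) auto
    fix p assume "p \<in> {(y, z) \<in> ?Y \<times> ?Y. y \<noteq> z}"
    then show "countable (case p of (y, z) \<Rightarrow> {t. poly (P y - P z) t = 0})"
      using neq by (auto intro!: countable_finite poly_roots_finite simp del: poly_diff)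
  qed
  then have "\<not> {0<..<1} \<subseteq> bad"
    using uncountable_open_interval[of 0 1] countable_subset by auto
  then obtain t where "t \<in> {0<..<1}" "t \<notin> bad"
    by blast
  then have t: "t > 0" "t \<notin> bad"
    by auto
  have "poly (P y) t = (\<Prod>j\<in>J. (t + real j) ^ y j)" for y
    by (simp add: P_def poly_prod add.commute)
  then show ?thesis
    using t by (intro exI[of _ t]) (auto simp: bad_def)
qed

section \<open>Decomposable circuits are not simulated by deterministic ones\<close>

fun weighted_sum :: "real \<Rightarrow> nat \<Rightarrow> formula" where
  "weighted_sum t 0 = FConst t"
| "weighted_sum t (Suc n) = FPlus (FTimes (FConst (2 ^ n)) (FPos n)) (weighted_sum t n)"

lemma weighted_sum_val: "fval a (weighted_sum t n) = t + (\<Sum>i<n. 2 ^ i * a i)"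
  by (induction n) auto

lemma weighted_sum_size: "length (subs (weighted_sum t n)) = 4 * n + 1"
  by (induction n) auto

lemma weighted_sum_D_ACm: "t \<ge> 0 \<Longrightarrow> formula_ac (weighted_sum t n) \<in> D_ACm"
proof -
  assume "t \<ge> 0"
  then have "c \<ge> 0" if "FConst c \<in> set (subs (weighted_sum t n))" for c
    using that by (induction n) auto
  moreover have "(fpos f \<union> fneg f) \<inter> (fpos g \<union> fneg g) = {}" if "FTimes f g \<in> set (subs (weighted_sum t n))" for f g
    using that by (induction n) auto
  ultimately show ?thesis
    by (simp add: D_ACm_def ACm_def formula_ac formula_monotone formula_decomposable)
qed

text \<open>\<open>set_encode\<close> reads a subset of \<open>{..<k}\<close> as a binary number, so
  the index set is 0, ..., 2^k - 1 in the form in which assignments produce it.\<close>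

definition shift :: "nat \<Rightarrow> real" where
  "shift k = (SOME t. t > 0 \<and> (\<forall>y\<in>set_encode ` Pow {..<k} \<rightarrow>\<^sub>E UNIV. \<forall>z\<in>set_encode ` Pow {..<k} \<rightarrow>\<^sub>E UNIV.
    (\<Prod>j\<in>set_encode ` Pow {..<k}. (t + real j) ^ y j) = (\<Prod>j\<in>set_encode ` Pow {..<k}. (t + real j) ^ z j)
      \<longrightarrow> y = (z :: nat \<Rightarrow> nat)))"

lemma shift:
  "shift k > 0"
  "\<lbrakk>y \<in> set_encode ` Pow {..<k} \<rightarrow>\<^sub>E UNIV; z \<in> set_encode ` Pow {..<k} \<rightarrow>\<^sub>E UNIV;
    (\<Prod>j\<in>set_encode ` Pow {..<k}. (shift k + real j) ^ y j) = (\<Prod>j\<in>set_encode ` Pow {..<k}. (shift k + real j) ^ z j)\<rbrakk>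
    \<Longrightarrow> y = (z :: nat \<Rightarrow> nat)"
proof -
  have "finite (set_encode ` Pow {..<k})"
    by simp
  from someI_ex[OF exists_independent_shift[OF this], folded shift_def]
  show "shift k > 0"
    "\<lbrakk>y \<in> set_encode ` Pow {..<k} \<rightarrow>\<^sub>E UNIV; z \<in> set_encode ` Pow {..<k} \<rightarrow>\<^sub>E UNIV;
    (\<Prod>j\<in>set_encode ` Pow {..<k}. (shift k + real j) ^ y j) = (\<Prod>j\<in>set_encode ` Pow {..<k}. (shift k + real j) ^ z j)\<rbrakk>
    \<Longrightarrow> y = (z :: nat \<Rightarrow> nat)"
    by blast+
qed

text \<open>The inputs reach all 2^k values \<open>shift k + real j\<close>. With fewer nodes than
  values, their monomials in the constants would satisfy a multiplicative relation, which the choice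
  of \<open>shift\<close> excludes.\<close>

lemma deterministic_lower_bound:
  assumes C: "is_ac C" "deterministic C" and same: "same_function C (formula_ac (weighted_sum (shift k) k))"
  shows "2 ^ k \<le> ac_size C"
proof (rule ccontr)
  assume "\<not> 2 ^ k \<le> ac_size C"
  let ?J = "set_encode ` Pow {..<k}"
  have "card ?J = card (Pow {..<k})"
    by (rule card_image, rule inj_on_subset[OF inj_on_set_encode]) (auto intro: finite_subset)
  then have less: "card (nodes C) < card ?J"
    using \<open>\<not> 2 ^ k \<le> ac_size C\<close> by (simp add: card_Pow ac_size_def)
  have "\<exists>e :: nat \<Rightarrow> nat. shift k + real j = (\<Prod>h\<in>nodes C. const_of C h ^ e h)" if "j \<in> ?J" for j
  proof -
    obtain S where S: "S \<subseteq> {..<k}" "j = set_encode S"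
      using \<open>j \<in> ?J\<close> by auto
    let ?a = "\<lambda>i. if i \<in> S then 1 else 0 :: real"
    have "node_val C ?a (source C) = shift k + (\<Sum>i<k. 2 ^ i * ?a i)"
      using same unfolding same_function_iff[OF C(1) formula_ac] formula_ac_val weighted_sum_val by auto
    also have "(\<Sum>i<k. 2 ^ i * ?a i) = (\<Sum>i\<in>S. 2 ^ i)"
      by (rule sum.mono_neutral_cong_right) (use S in auto)
    also have "\<dots> = real j"
      by (simp add: S set_encode_def)
    finally have val: "node_val C ?a (source C) = shift k + real j" .
    then have "node_val C ?a (source C) \<noteq> 0"
      using shift(1)[of k] by simp
    from deterministic_monomial[OF C _ ac_source(2)[OF C(1)] this] val show ?thesis
      by auto
  qed
  then obtain e :: "nat \<Rightarrow> nat \<Rightarrow> nat" where e: "shift k + real j = (\<Prod>h\<in>nodes C. const_of C h ^ e j h)" if "j \<in> ?J" for j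
    by metis
  have "\<exists>y\<in>?J \<rightarrow>\<^sub>E UNIV. \<exists>z\<in>?J \<rightarrow>\<^sub>E UNIV. y \<noteq> z \<and>
      (\<Prod>j\<in>?J. (shift k + real j) ^ y j) = (\<Prod>j\<in>?J. (shift k + real j) ^ z j)"
    by (rule multiplicative_dependence[OF ac_finite[OF C(1)] _ less e]) auto
  then show False
    using shift(2)[of _ k] by blast
qed

lemma dwD_not_le_D: "\<not> dwD_ACm \<le>\<^sub>s D_ACm"
proof (rule not_succ_leI)
  show "formula_ac (weighted_sum (shift k) k) \<in> D_ACm" for k
    using shift(1)[of k] by (simp add: weighted_sum_D_ACm)
  show "real (ac_size (formula_ac (weighted_sum (shift k) k))) \<le> poly [:1, 4:] (real k)" for k
    using formula_size[of "weighted_sum (shift k) k"] by (simp add: weighted_sum_size)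
  show "2 ^ k \<le> real (ac_size C)" if "C \<in> dwD_ACm" "same_function C (formula_ac (weighted_sum (shift k) k))" for k C
    using deterministic_lower_bound[of C k] that by (simp add: dwD_ACm_def ACm_def flip: of_nat_le_iff)
qed simp

section \<open>Balanced nodes of smooth decomposable circuits\<close>

text \<open>
  The last conjunct expresses that \<open>g\<close> lies on a proof tree of \<open>a\<close>: the part of \<open>a\<close> that \<open>g\<close> reads
  may be replaced by any assignment in the support of \<open>g\<close>.
\<close>

definition live :: "circuit \<Rightarrow> (nat \<Rightarrow> real) \<Rightarrow> nat \<Rightarrow> bool" where
  "live C a g \<longleftrightarrow> g \<in> nodes C \<and> node_val C a g \<noteq> 0 \<and>
     (\<forall>b. (\<forall>x. b x \<in> {0, 1}) \<longrightarrow> (\<forall>x. x \<notin> node_var C g \<longrightarrow> b x = a x) \<longrightarrow> node_val C b g \<noteq> 0 \<longrightarrow>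
        node_val C b (source C) \<noteq> 0)"

text \<open>The mixture looks like \<open>a\<close> to \<open>g\<close> and equals \<open>b\<close>
  on all variables outside, so it is one of the replacements that liveness for \<open>b\<close>
  permits.\<close>

lemma live_mix:
  assumes C: "is_ac C" and live: "live C a g" "live C b g"
    and a: "\<forall>x. a x \<in> {0, 1}" and b: "\<forall>x. b x \<in> {0, 1}"
  shows "node_val C (\<lambda>x. if x \<in> node_var C g then a x else b x) (source C) \<noteq> 0"
proof -
  let ?m = "\<lambda>x. if x \<in> node_var C g then a x else b x"
  have "node_val C ?m g = node_val C a g"
    by (rule node_val_cong[OF C]) (use live in \<open>auto simp: live_def\<close>)
  then have "node_val C ?m g \<noteq> 0"
    using live(1) by (simp add: live_def)
  moreover have "\<forall>x. ?m x \<in> {0, 1}"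
    using a b by auto
  ultimately show ?thesis
    using live(2) unfolding live_def by auto
qed

text \<open>Monotonicity excludes cancellation, so one nonzero summand keeps the sum nonzero. By
  smoothness the summand reads all variables of \<open>g\<close> and admits the same
  replacements.\<close>

lemma live_Plus:
  assumes C: "is_ac C" "smooth C" "monotone_ac C"
    and live: "live C a g" and G: "gate C g = Plus l r"
  shows "(live C a l \<or> live C a r) \<and> node_var C l = node_var C g \<and> node_var C r = node_var C g"
proof -
  have g: "g \<in> nodes C"
    using live by (simp add: live_def)
  have lr: "l \<in> nodes C" "r \<in> nodes C"
    using ac_succ[OF C(1) g] G by auto
  have "node_var C l = node_var C r"
    using C(2) g G by (simp add: smooth_def)
  then have var: "node_var C l = node_var C g" "node_var C r = node_var C g"
    using node_var_gate[OF C(1) g] G by auto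
  have val: "node_val C b g = node_val C b l + node_val C b r" for b
    using node_val_gate[OF C(1) g] G by simp
  have up: "node_val C b g \<noteq> 0" if "\<forall>x. b x \<in> {0, 1}" "h \<in> {l, r}" "node_val C b h \<noteq> 0" for b h
    using that node_val_nonneg[OF C(1,3) lr(1), of b] node_val_nonneg[OF C(1,3) lr(2), of b]
    by (auto simp: val add_nonneg_eq_0_iff)
  have "live C a h" if "h \<in> {l, r}" "node_val C a h \<noteq> 0" for h
    unfolding live_def
  proof (intro conjI allI impI)
    fix b assume b: "\<forall>x. b x \<in> {0, 1}" "\<forall>x. x \<notin> node_var C h \<longrightarrow> b x = a x" "node_val C b h \<noteq> 0"
    moreover have "node_var C h = node_var C g"
      using that(1) var by auto
    ultimately show "node_val C b (source C) \<noteq> 0"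
      using live up[OF b(1) that(1) b(3)] unfolding live_def by metis
  qed (use that lr in auto)
  moreover have "node_val C a l \<noteq> 0 \<or> node_val C a r \<noteq> 0"
    using live by (auto simp: live_def val)
  ultimately show ?thesis
    using var by blast
qed

text \<open>The sibling does not read what is replaced below \<open>l\<close>, so it keeps its
  nonzero value.\<close>

lemma live_Times:
  assumes C: "is_ac C" "decomposable C"
    and live: "live C a g" and G: "gate C g = Times l r \<or> gate C g = Times r l"
  shows "live C a l"
proof -
  have g: "g \<in> nodes C"
    using live by (simp add: live_def)
  have lr: "l \<in> nodes C" "r \<in> nodes C"
    using ac_succ[OF C(1) g] G by auto
  have disj: "node_var C l \<inter> node_var C r = {}"
    using C(2) g G unfolding decomposable_def by blast
  have val: "node_val C b g = node_val C b l * node_val C b r" for b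
    using G
  proof
    assume "gate C g = Times r l"
    then show ?thesis
      by (simp add: node_val_gate[OF C(1) g] mult.commute)
  qed (simp add: node_val_gate[OF C(1) g])
  have sub: "node_var C l \<subseteq> node_var C g"
    using G by (intro node_var_succ(1)[OF C(1) g]) auto
  show ?thesis
    unfolding live_def
  proof (intro conjI allI impI)
    show "l \<in> nodes C" "node_val C a l \<noteq> 0"
      using lr live by (auto simp: live_def val)
    fix b assume b: "\<forall>x. b x \<in> {0, 1}" "\<forall>x. x \<notin> node_var C l \<longrightarrow> b x = a x" "node_val C b l \<noteq> 0"
    have "node_val C b r = node_val C a r"
      by (rule node_val_cong[OF C(1) lr(2)]) (use b(2) disj in auto)
    then have "node_val C b g \<noteq> 0"
      using b(3) live by (auto simp: live_def val)
    then show "node_val C b (source C) \<noteq> 0"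
      using live b(1,2) sub unfolding live_def by blast
  qed
qed

text \<open>Descend from the source along live nodes. A sum passes on all its variables, and a
  product that reads more than 2k elements of \<open>S\<close> has an operand that reads at least k.
  The first node with at most 2k elements therefore still has at least k.\<close>

lemma balanced_node:
  assumes C: "is_ac C" "smooth C" "decomposable C" "monotone_ac C"
    and S: "finite S" "S \<subseteq> ac_var C" "card S = 3 * k" "k \<ge> 1"
    and a: "node_val C a (source C) \<noteq> 0"
  shows "\<exists>g. live C a g \<and> k \<le> card (S \<inter> node_var C g) \<and> card (S \<inter> node_var C g) \<le> 2 * k"
proof -
  have descend: "\<exists>g. live C a g \<and> k \<le> card (S \<inter> node_var C g) \<and> card (S \<inter> node_var C g) \<le> 2 * k"
    if "g \<in> nodes C" "live C a g" "k \<le> card (S \<inter> node_var C g)" for g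
    using C(1) that
  proof (induction rule: ac_induct)
    case (node g)
    show ?case
    proof (cases "card (S \<inter> node_var C g) \<le> 2 * k")
      case True
      then show ?thesis
        using node.prems by blast
    next
      case False
      \<comment> \<open>In this case the count exceeds 2k \<ge> 2, so \<open>g\<close> cannot be a
        sink.\<close>
      have leaf: "card (S \<inter> {x}) \<le> 1" for x
        using card_mono[of "{x}" "S \<inter> {x}"] by simp
      note var = node_var_gate[OF C(1) node(1)]
      show ?thesis
      proof (cases "gate C g")
        case (Plus l r)
        then show ?thesis
          using live_Plus[OF C(1,2,4) node.prems(1) Plus] node.IH[of l] node.IH[of r] node.prems(2) by auto
      next
        case (Times l r)
        have "card (S \<inter> node_var C g) \<le> card (S \<inter> node_var C l) + card (S \<inter> node_var C r)"
          using Times var card_Un_le[of "S \<inter> node_var C l" "S \<inter> node_var C r"] by (simp add: Int_Un_distrib)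
        then have "k \<le> card (S \<inter> node_var C l) \<or> k \<le> card (S \<inter> node_var C r)"
          using False by linarith
        then show ?thesis
          using live_Times[OF C(1,3) node.prems(1)] Times node.IH[of l] node.IH[of r] by auto
      next
        case (Const c)
        then show ?thesis
          using False var by simp
      next
        case (PosLit x)
        then show ?thesis
          using False var leaf[of x] \<open>k \<ge> 1\<close> by simp
      next
        case (NegLit x)
        then show ?thesis
          using False var leaf[of x] \<open>k \<ge> 1\<close> by simp
      qed
    qed
  qed
  have "live C a (source C)"
    using a ac_source(2)[OF C(1)] by (simp add: live_def)
  moreover have "S \<inter> node_var C (source C) = S"
    using S(2) by (auto simp: ac_var_def)
  ultimately show ?thesis
    using descend[OF ac_source(2)[OF C(1)]] S by simp
qed

section \<open>Deterministic weakly decomposable circuits are not simulated by decomposable ones\<close>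

text \<open>
  Row \<open>i\<close> is a decision list: the first column \<open>j\<close> selected by the variables \<open>row_var i j\<close> must be
  switched on by the variable \<open>col_var j\<close>, which is shared by all rows.
\<close>

definition col_var :: "nat \<Rightarrow> nat" where
  "col_var j = prod_encode (0, j)"

definition row_var :: "nat \<Rightarrow> nat \<Rightarrow> nat" where
  "row_var i j = prod_encode (Suc i, j)"

lemma var_eq [simp]: "col_var j \<noteq> row_var i j'" "row_var i j' \<noteq> col_var j"
  "col_var j = col_var j' \<longleftrightarrow> j = j'" "row_var i j = row_var i' j' \<longleftrightarrow> i = i' \<and> j = j'"
  by (auto simp: col_var_def row_var_def)

text \<open>The final 0 rejects a row that selects nothing. The opposite literals of
  \<open>row_var i j\<close> in the two branches make each sum deterministic.\<close>

fun row :: "nat \<Rightarrow> nat \<Rightarrow> nat \<Rightarrow> formula" where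
  "row i j 0 = FConst 0"
| "row i j (Suc m) = FPlus (FTimes (FPos (row_var i j)) (FPos (col_var j)))
     (FTimes (FNeg (row_var i j)) (row i (Suc j) m))"

fun rows :: "nat \<Rightarrow> nat \<Rightarrow> formula" where
  "rows 0 m = FConst 1"
| "rows (Suc i) m = FTimes (row i 0 m) (rows i m)"

lemma row_size: "length (subs (row i j m)) = 6 * m + 1"
  by (induction m arbitrary: j) auto

lemma rows_size: "length (subs (rows n m)) = n * (6 * m + 2) + 1"
  by (induction n) (auto simp: row_size)

lemma row_var_sets:
  "fpos (row i j m) = row_var i ` {j..<j + m} \<union> col_var ` {j..<j + m} \<and>
   fneg (row i j m) = row_var i ` {j..<j + m}"
proof (induction m arbitrary: j)
  case (Suc m)
  have "{j..<j + Suc m} = insert j {Suc j..<Suc j + m}"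
    by auto
  then show ?case
    using Suc[of "Suc j"] by auto
qed auto

lemma rows_var_sets:
  "fpos (rows n m) = (\<Union>i<n. row_var i ` {..<m} \<union> col_var ` {..<m})"
  "fneg (rows n m) = (\<Union>i<n. row_var i ` {..<m})"
  by (induction n) (auto simp: row_var_sets lessThan_Suc atLeast0LessThan)

lemma row_nonzero_iff:
  assumes "\<forall>x. a x \<in> {0, 1}"
  shows "fval a (row i j m) \<noteq> 0 \<longleftrightarrow> (\<exists>c\<in>{j..<j + m}. a (row_var i c) = 1 \<and> a (col_var c) = 1 \<and>
      (\<forall>d\<in>{j..<c}. a (row_var i d) = 0))"
proof (induction m arbitrary: j)
  case (Suc m)
  have split: "(\<exists>c\<in>{j..<j + Suc m}. a (row_var i c) = 1 \<and> a (col_var c) = 1 \<and> (\<forall>d\<in>{j..<c}. a (row_var i d) = 0))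
    \<longleftrightarrow> a (row_var i j) = 1 \<and> a (col_var j) = 1 \<or> a (row_var i j) = 0 \<and>
      (\<exists>c\<in>{Suc j..<Suc j + m}. a (row_var i c) = 1 \<and> a (col_var c) = 1 \<and> (\<forall>d\<in>{Suc j..<c}. a (row_var i d) = 0))"
    (is "?L \<longleftrightarrow> ?R")
  proof
    assume ?L
    then obtain c where c: "c \<in> {j..<j + Suc m}" "a (row_var i c) = 1" "a (col_var c) = 1"
      "\<forall>d\<in>{j..<c}. a (row_var i d) = 0"
      by blast
    show ?R
      by (cases "c = j") (use c in auto)
  next
    assume ?R
    then show ?L
    proof
      assume "a (row_var i j) = 0 \<and>
        (\<exists>c\<in>{Suc j..<Suc j + m}. a (row_var i c) = 1 \<and> a (col_var c) = 1 \<and> (\<forall>d\<in>{Suc j..<c}. a (row_var i d) = 0))"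
      then obtain c where c: "a (row_var i j) = 0" "c \<in> {Suc j..<Suc j + m}" "a (row_var i c) = 1"
        "a (col_var c) = 1" "\<forall>d\<in>{Suc j..<c}. a (row_var i d) = 0"
        by blast
      have "a (row_var i d) = 0" if "d \<in> {j..<c}" for d
        using that c(1,5) by (cases "d = j") auto
      then show ?L
        using c by (intro bexI[of _ c]) auto
    qed auto
  qed
  have "a (row_var i j) = 0 \<or> a (row_var i j) = 1" "a (col_var j) = 0 \<or> a (col_var j) = 1"
    using assms by auto
  then show ?case
    unfolding split Suc[symmetric] by auto
qed auto

lemma rows_nonzero_iff:
  assumes "\<forall>x. a x \<in> {0, 1}"
  shows "fval a (rows n m) \<noteq> 0 \<longleftrightarrow> (\<forall>i<n. \<exists>c<m. a (row_var i c) = 1 \<and> a (col_var c) = 1 \<and>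
      (\<forall>d<c. a (row_var i d) = 0))"
proof (induction n)
  case (Suc n)
  have "fval a (row n 0 m) \<noteq> 0 \<longleftrightarrow> (\<exists>c<m. a (row_var n c) = 1 \<and> a (col_var c) = 1 \<and> (\<forall>d<c. a (row_var n d) = 0))"
    using row_nonzero_iff[OF assms, of n 0 m] by (auto simp: Bex_def Ball_def)
  then show ?case
    using Suc by (auto simp: less_Suc_eq)
qed auto

text \<open>Different rows share column variables only, and these occur only positively; inside a
  row all products are decomposable.\<close>

lemma rows_dwD_ACm: "formula_ac (rows n m) \<in> dwD_ACm"
proof -
  have const: "c \<ge> 0" if "FConst c \<in> set (subs (row i j m))" for c i j
    using that by (induction m arbitrary: j) auto
  have mono: "c \<ge> 0" if "FConst c \<in> set (subs (rows n m))" for c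
    using that const by (induction n) auto
  have times: "(fpos f \<union> fneg f) \<inter> (fpos g \<union> fneg g) = {}" if "FTimes f g \<in> set (subs (row i j m))" for f g i j
    using that by (induction m arbitrary: j) (auto simp: row_var_sets)
  have weak: "(fpos f \<union> fneg f) \<inter> (fpos g \<union> fneg g) \<inter> (fpos f \<union> fpos g) \<inter> (fneg f \<union> fneg g) = {}"
    if "FTimes f g \<in> set (subs (rows n m))" for f g
    using that
  proof (induction n)
    case (Suc n)
    then consider "f = row n 0 m" "g = rows n m" | "FTimes f g \<in> set (subs (row n 0 m))"
      | "FTimes f g \<in> set (subs (rows n m))"
      by auto
    then show ?case
    proof cases
      case 1
      then show ?thesis
        by (auto simp: row_var_sets rows_var_sets)
    next
      case 2
      then show ?thesis
        using times by fast
    next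
      case 3
      then show ?thesis
        using Suc.IH by simp
    qed
  qed auto
  have plus: "fval a f = 0 \<or> fval a g = 0" if "FPlus f g \<in> set (subs (row i j m))" "\<forall>x. a x \<in> {0, 1}" for f g i j a
    using that
  proof (induction m arbitrary: j)
    case (Suc m)
    have "a (row_var i j) = 0 \<or> a (row_var i j) = 1"
      using Suc.prems(2) by auto
    then show ?case
      using Suc by auto
  qed auto
  have det: "fval a f = 0 \<or> fval a g = 0" if "FPlus f g \<in> set (subs (rows n m))" "\<forall>x. a x \<in> {0, 1}" for f g a
    using that(1)
  proof (induction n)
    case (Suc n)
    then show ?case
      using plus[of f g n 0 a] that(2) by auto
  qed auto
  show ?thesis
    using formula_monotone[OF mono] formula_weakly_decomposable[OF weak] formula_deterministic[OF det]
    by (simp add: dwD_ACm_def ACm_def formula_ac)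
qed

text \<open>Row \<open>i\<close> selects column \<open>z i\<close>, and only the selected columns
  are on. Fewer columns would make the function 0 here; more would let more mixtures
  survive.\<close>

definition hard :: "nat \<Rightarrow> (nat \<Rightarrow> nat) \<Rightarrow> nat \<Rightarrow> real" where
  "hard n z v = (case prod_decode v of (0, j) \<Rightarrow> of_bool (j \<in> z ` {..<n}) | (Suc i, j) \<Rightarrow> of_bool (z i = j))"

lemma hard [simp]:
  "hard n z (col_var j) = of_bool (j \<in> z ` {..<n})"
  "hard n z (row_var i j) = of_bool (z i = j)"
  by (simp_all add: hard_def col_var_def row_var_def)

lemma hard_bool: "hard n z x \<in> {0, 1}"
  by (auto simp: hard_def split: prod.split nat.split)

text \<open>\<open>T\<close> stands for the inputs collected at one node and \<open>X\<close> for
  its variables. Mix \<open>z\<close> inside \<open>X\<close> with a fixed \<open>z0\<close>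
  outside: a row read inside \<open>X\<close> keeps the column chosen by \<open>z\<close>, which
  must be on by \<open>z\<close> if its variable is in \<open>X\<close> and by \<open>z0\<close>
  otherwise, so it lies in \<open>P\<close>. The opposite mixture puts the choices of the other rows
  into \<open>Q\<close>.\<close>

lemma hard_class_bound:
  assumes T: "T \<subseteq> {..<n} \<rightarrow>\<^sub>E {..<2 * n}" and n: "n = 3 * k"
    and mix: "\<And>z w. z \<in> T \<Longrightarrow> w \<in> T \<Longrightarrow> fval (\<lambda>x. if x \<in> X then hard n z x else hard n w x) (rows n (2 * n)) \<noteq> 0"
    and balanced: "\<And>z. z \<in> T \<Longrightarrow> k \<le> card {i. i < n \<and> row_var i (z i) \<in> X} \<and> card {i. i < n \<and> row_var i (z i) \<in> X} \<le> 2 * k"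
  shows "4 ^ k * card T \<le> 3 ^ k * (2 * n) ^ n"
proof (cases "T = {}")
  case False
  then obtain z0 where z0: "z0 \<in> T"
    by blast
  define I where "I = {i. i < n \<and> row_var i (z0 i) \<in> X}"
  define J where "J = {c. c < 2 * n \<and> col_var c \<in> X}"
  define A where "A = z0 ` {..<n}"
  define P where "P = J \<union> (A - J)"
  define Q where "Q = ({..<2 * n} - J) \<union> (A \<inter> J)"
  have pick: "row_var i (z i) \<in> X \<and> (col_var (z i) \<in> X \<or> z i \<in> w ` {..<n}) \<or>
      row_var i (w i) \<notin> X \<and> (col_var (w i) \<notin> X \<or> w i \<in> z ` {..<n})"
    if zw: "z \<in> T" "w \<in> T" and "i < n" for z w i
  proof -
    let ?m = "\<lambda>x. if x \<in> X then hard n z x else hard n w x"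
    have "\<forall>x. ?m x \<in> {0, 1}"
      using hard_bool by auto
    from mix[OF zw, unfolded rows_nonzero_iff[OF this]] \<open>i < n\<close>
    obtain c where "?m (row_var i c) = 1" "?m (col_var c) = 1"
      by blast
    then show ?thesis
      by (auto split: if_splits)
  qed
  \<comment> \<open>Mixing with \<open>z0\<close> in both orders: each mixture must contain a
    selecting literal for row \<open>i\<close>, so whether that literal is in \<open>X\<close> is
    the same for all inputs in \<open>T\<close>.\<close>
  have I: "row_var i (z i) \<in> X \<longleftrightarrow> i \<in> I" if "z \<in> T" "i < n" for z i
    using pick[OF that(1) z0 that(2)] pick[OF z0 that(1,2)] that(2) by (auto simp: I_def)
  have range: "z i < 2 * n" if "z \<in> T" "i < n" for z i
    using T that by (auto simp: PiE_iff)
  have "T \<subseteq> (\<Pi>\<^sub>E i\<in>{..<n}. if i \<in> I then P else Q)"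
  proof
    fix z assume z: "z \<in> T"
    show "z \<in> (\<Pi>\<^sub>E i\<in>{..<n}. if i \<in> I then P else Q)"
    proof (rule PiE_I)
      fix i assume "i \<in> {..<n}"
      then have i: "i < n"
        by simp
      show "z i \<in> (if i \<in> I then P else Q)"
        using pick[OF z z0 i] pick[OF z0 z i] I[OF z i] I[OF z0 i] range[OF z i]
        by (auto simp: P_def Q_def J_def A_def)
    next
      show "z i = undefined" if "i \<notin> {..<n}" for i
        using z T that by (auto simp: PiE_iff extensional_def)
    qed
  qed
  moreover have A: "A \<subseteq> {..<2 * n}" "card A \<le> n"
    using range[OF z0] card_image_le[of "{..<n}" z0] by (auto simp: A_def)
  then have sub: "P \<subseteq> {..<2 * n}" "Q \<subseteq> {..<2 * n}" "J \<subseteq> {..<2 * n}"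
    by (auto simp: P_def Q_def J_def)
  then have fin: "finite P" "finite Q" "finite J" "finite A"
    using A finite_subset by blast+
  ultimately have "card T \<le> card (\<Pi>\<^sub>E i\<in>{..<n}. if i \<in> I then P else Q)"
    by (intro card_mono finite_PiE) auto
  also have "\<dots> = (\<Prod>i<n. if i \<in> I then card P else card Q)"
    by (simp add: card_PiE if_distrib cong: if_cong)
  also have "\<dots> = card P ^ card I * card Q ^ card ({..<n} - I)"
  proof -
    have "{..<n} \<inter> {i. i \<in> I} = I" "{..<n} \<inter> - {i. i \<in> I} = {..<n} - I"
      by (auto simp: I_def)
    then show ?thesis
      by (simp add: prod.If_cases)
  qed
  also have "card ({..<n} - I) = n - card I"
    by (subst card_Diff_subset) (auto simp: I_def)
  finally have T_le: "card T \<le> card P ^ card I * card Q ^ (n - card I)" .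
  have "card P \<le> card J + card (A - J)" "card Q \<le> (2 * n - card J) + card (A \<inter> J)"
    using card_Un_le[of J "A - J"] card_Un_le[of "{..<2 * n} - J" "A \<inter> J"] sub(3) fin
    by (simp_all add: P_def Q_def card_Diff_subset)
  moreover have "card (A - J) + card (A \<inter> J) = card A"
    using card_Int_Diff[OF fin(4), of J] by simp
  moreover have "card J \<le> 2 * n"
    using card_mono[OF _ sub(3)] by simp
  \<comment> \<open>\<open>J\<close> and its complement contribute 2n together, and \<open>A\<close>
    is divided between the two sets.\<close>
  ultimately have "card P + card Q \<le> 3 * n"
    using A(2) by linarith
  then have small: "4 * card P \<le> 3 * (2 * n) \<or> 4 * card Q \<le> 3 * (2 * n)"
    by linarith
  have PQ: "card P \<le> 2 * n" "card Q \<le> 2 * n"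
    using card_mono[OF _ sub(1)] card_mono[OF _ sub(2)] by simp_all
  \<comment> \<open>Of the \<open>u\<close> factors \<open>p\<close>, only \<open>k\<close> are
    charged with 3/4 of \<open>N\<close>; all the others are bounded by \<open>N\<close>.\<close>
  have power_le: "4 ^ k * (p ^ u * q ^ (n - u)) \<le> 3 ^ k * N ^ n"
    if "4 * p \<le> 3 * N" "p \<le> N" "q \<le> N" "k \<le> u" "u \<le> n" for p q u N :: nat
  proof -
    have "4 ^ k * (p ^ u * q ^ (n - u)) = (4 * p) ^ k * p ^ (u - k) * q ^ (n - u)"
      using that(4) by (simp add: power_mult_distrib flip: power_add)
    also have "\<dots> \<le> (3 * N) ^ k * N ^ (u - k) * N ^ (n - u)"
      using power_mono[OF that(1), of k] power_mono[OF that(2), of "u - k"] power_mono[OF that(3), of "n - u"]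
      by (intro mult_le_mono) simp_all
    also have "\<dots> = 3 ^ k * N ^ n"
      using that(4,5) by (simp add: power_mult_distrib mult.assoc flip: power_add)
    finally show ?thesis .
  qed
  have I_card: "k \<le> card I" "card I \<le> 2 * k"
    using balanced[OF z0] by (auto simp: I_def)
  have "4 ^ k * (card P ^ card I * card Q ^ (n - card I)) \<le> 3 ^ k * (2 * n) ^ n"
    using small
  proof
    assume "4 * card P \<le> 3 * (2 * n)"
    then show ?thesis
      by (rule power_le) (use PQ I_card n in auto)
  next
    \<comment> \<open>\<open>Q\<close> has the exponent \<open>n - card I\<close>, which is at least
      \<open>k\<close> by the upper bound of the balance.\<close>
    assume "4 * card Q \<le> 3 * (2 * n)"
    then have "4 ^ k * (card Q ^ (n - card I) * card P ^ (n - (n - card I))) \<le> 3 ^ k * (2 * n) ^ n"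
      by (rule power_le) (use PQ I_card n in auto)
    then show ?thesis
      using I_card n by (simp add: mult.commute)
  qed
  then show ?thesis
    using mult_le_mono2[OF T_le, of "4 ^ k"] by linarith
qed auto

text \<open>Every choice vector has a live balanced node, and a single node accounts for at most a
  fraction (3/4)^k of all \<open>(2 * n) ^ n\<close> vectors.\<close>

lemma decomposable_lower_bound:
  assumes C: "is_ac C" "smooth C" "decomposable C" "monotone_ac C" and k: "k \<ge> 1"
    and same: "same_function C (formula_ac (rows (3 * k) (6 * k)))"
  shows "4 ^ k \<le> ac_size C * 3 ^ k"
proof -
  define n where "n = 3 * k"
  have N: "6 * k = 2 * n"
    by (simp add: n_def)
  have var: "ac_var C = fpos (rows n (2 * n)) \<union> fneg (rows n (2 * n))"
    and val: "\<And>a. \<forall>x. a x \<in> {0, 1} \<Longrightarrow> node_val C a (source C) = fval a (rows n (2 * n))"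
    using same unfolding same_function_iff[OF C(1) formula_ac] formula_ac_val formula_ac_var N n_def[symmetric]
    by auto
  define Z where "Z = ({..<n} \<rightarrow>\<^sub>E {..<2 * n})"
  define sel where "sel z = (\<lambda>i. row_var i (z i)) ` {..<n}" for z
  have sel_card: "card (sel z \<inter> X) = card {i. i < n \<and> row_var i (z i) \<in> X}" for z X
  proof -
    have "sel z \<inter> X = (\<lambda>i. row_var i (z i)) ` {i. i < n \<and> row_var i (z i) \<in> X}"
      by (auto simp: sel_def)
    then show ?thesis
      by (simp add: card_image inj_on_def)
  qed
  define T where "T g = {z \<in> Z. live C (hard n z) g \<and> k \<le> card (sel z \<inter> node_var C g) \<and>
      card (sel z \<inter> node_var C g) \<le> 2 * k}" for g
  have "Z \<subseteq> (\<Union>g\<in>nodes C. T g)"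
  proof
    fix z assume z: "z \<in> Z"
    have "fval (hard n z) (rows n (2 * n)) \<noteq> 0"
      unfolding rows_nonzero_iff[OF allI[OF hard_bool]] using z
      by (auto simp: Z_def PiE_iff)
    then have "node_val C (hard n z) (source C) \<noteq> 0"
      using val hard_bool by simp
    moreover have "sel z \<subseteq> ac_var C"
      using z by (auto simp: sel_def var rows_var_sets Z_def PiE_iff)
    moreover have "card (sel z) = 3 * k"
      using sel_card[of z UNIV] by (simp add: n_def)
    ultimately obtain g where "live C (hard n z) g" "k \<le> card (sel z \<inter> node_var C g)"
      "card (sel z \<inter> node_var C g) \<le> 2 * k"
      using balanced_node[OF C _ _ _ k, of "sel z" "hard n z"] by (auto simp: sel_def)
    then show "z \<in> (\<Union>g\<in>nodes C. T g)"
      using z by (auto simp: T_def live_def)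
  qed
  moreover have finZ: "finite Z"
    by (auto simp: Z_def intro: finite_PiE)
  moreover have "finite (T g)" for g
    by (rule finite_subset[OF _ finZ]) (auto simp: T_def)
  ultimately have "card Z \<le> card (\<Union>g\<in>nodes C. T g)"
    using ac_finite[OF C(1)] by (intro card_mono) auto
  also have "\<dots> \<le> (\<Sum>g\<in>nodes C. card (T g))"
    by (rule card_UN_le[OF ac_finite[OF C(1)]])
  finally have "4 ^ k * card Z \<le> (\<Sum>g\<in>nodes C. 4 ^ k * card (T g))"
    by (simp flip: sum_distrib_left)
  also have "\<dots> \<le> (\<Sum>g\<in>nodes C. 3 ^ k * (2 * n) ^ n)"
  proof (rule sum_mono)
    fix g assume "g \<in> nodes C"
    show "4 ^ k * card (T g) \<le> 3 ^ k * (2 * n) ^ n"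
    proof (rule hard_class_bound[OF _ n_def, where X = "node_var C g"])
      show "T g \<subseteq> {..<n} \<rightarrow>\<^sub>E {..<2 * n}"
        by (auto simp: T_def Z_def)
      fix z assume z: "z \<in> T g"
      then show "k \<le> card {i. i < n \<and> row_var i (z i) \<in> node_var C g} \<and>
          card {i. i < n \<and> row_var i (z i) \<in> node_var C g} \<le> 2 * k"
        by (simp add: T_def sel_card)
      fix w assume w: "w \<in> T g"
      let ?m = "\<lambda>x. if x \<in> node_var C g then hard n z x else hard n w x"
      have "\<forall>x. ?m x \<in> {0, 1}"
        using hard_bool by auto
      moreover have "node_val C ?m (source C) \<noteq> 0"
        by (rule live_mix[OF C(1)]) (use z w hard_bool in \<open>auto simp: T_def\<close>)
      ultimately show "fval ?m (rows n (2 * n)) \<noteq> 0"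
        using val by simp
    qed
  qed
  also have "\<dots> = ac_size C * 3 ^ k * (2 * n) ^ n"
    by (simp add: ac_size_def)
  also have "card Z = (2 * n) ^ n"
    by (simp add: Z_def card_PiE)
  finally show ?thesis
    using k by (simp add: n_def)
qed

lemma sD_not_le_dwD: "\<not> sD_ACm \<le>\<^sub>s dwD_ACm"
proof (rule not_succ_leI)
  show "formula_ac (rows (3 * k) (6 * k)) \<in> dwD_ACm" for k
    by (rule rows_dwD_ACm)
  show "real (ac_size (formula_ac (rows (3 * k) (6 * k)))) \<le> poly [:1, 6, 108:] (real k)" for k
  proof -
    have "real (ac_size (formula_ac (rows (3 * k) (6 * k)))) \<le> real (3 * k * (6 * (6 * k) + 2) + 1)"
      using formula_size[of "rows (3 * k) (6 * k)"] unfolding rows_size by (rule of_nat_mono)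
    also have "\<dots> = poly [:1, 6, 108:] (real k)"
      by (simp add: algebra_simps)
    finally show ?thesis .
  qed
  fix k :: nat and C
  assume "k \<ge> 1" "C \<in> sD_ACm" "same_function C (formula_ac (rows (3 * k) (6 * k)))"
  then have "4 ^ k \<le> ac_size C * 3 ^ k"
    by (intro decomposable_lower_bound) (auto simp: sD_ACm_def ACm_def)
  then have "real (4 ^ k) \<le> real (ac_size C * 3 ^ k)"
    by (rule of_nat_mono)
  then show "(4 / 3) ^ k \<le> real (ac_size C)"
    by (simp add: power_divide divide_le_eq)
qed simp

theorem theorem1:
  shows
    "(wD_ACm <\<^sub>s D_ACm \<and> wD_ACm <\<^sub>s swD_ACm \<and> wD_ACm <\<^sub>s dwD_ACm)
   \<and> (D_ACm \<simeq>\<^sub>s sD_ACm \<and> sD_ACm \<simeq>\<^sub>s swD_ACm)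
   \<and> (D_ACm <\<^sub>s dD_ACm \<and> sD_ACm <\<^sub>s sdD_ACm \<and> swD_ACm <\<^sub>s sdwD_ACm)
   \<and> (dwD_ACm <\<^sub>s dD_ACm \<and> dwD_ACm <\<^sub>s sdwD_ACm)
   \<and> (dD_ACm \<simeq>\<^sub>s sdD_ACm \<and> sdD_ACm \<simeq>\<^sub>s sdwD_ACm)
   \<and> (\<not> dwD_ACm \<le>\<^sub>s D_ACm \<and> \<not> D_ACm \<le>\<^sub>s dwD_ACm)"
proof -
  note incl = class_inclusions[THEN succ_le_superset]
  have eq: "sD_ACm \<le>\<^sub>s D_ACm" "sD_ACm \<le>\<^sub>s swD_ACm" "swD_ACm \<le>\<^sub>s D_ACm" "D_ACm \<le>\<^sub>s swD_ACm"
    using incl sD_le_D sD_le_swD succ_le_trans by blast+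
  have deq: "sdD_ACm \<le>\<^sub>s dD_ACm" "sdD_ACm \<le>\<^sub>s sdwD_ACm" "dD_ACm \<le>\<^sub>s sdwD_ACm" "sdwD_ACm \<le>\<^sub>s dD_ACm"
    using incl sdD_le_dD sdD_le_sdwD succ_le_trans by blast+
  \<comment> \<open>As sD simulates D, a simulation of dwD by D would yield one by sD; assuming
    smoothness in the lower bound therefore loses nothing.\<close>
  have D: "\<not> D_ACm \<le>\<^sub>s dwD_ACm"
    using sD_not_le_dwD sD_le_D succ_le_trans by blast
  \<comment> \<open>wD simulates both D and dwD by inclusion, so a simulation of wD by either of
    them would let it simulate the other.\<close>
  have 1: "\<not> D_ACm \<le>\<^sub>s wD_ACm" "\<not> swD_ACm \<le>\<^sub>s wD_ACm" "\<not> dwD_ACm \<le>\<^sub>s wD_ACm"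
    using D dwD_not_le_D incl eq succ_le_trans by blast+
  \<comment> \<open>dwD simulates dD and its equivalents; if one of these simulated D up to
    equivalence, so would dwD.\<close>
  have 2: "\<not> dD_ACm \<le>\<^sub>s D_ACm" "\<not> sdD_ACm \<le>\<^sub>s sD_ACm" "\<not> sdwD_ACm \<le>\<^sub>s swD_ACm"
    using dwD_not_le_D incl eq deq succ_le_trans by blast+
  \<comment> \<open>D simulates dD and its equivalents; if one of these simulated dwD, so would
    D.\<close>
  have 3: "\<not> dD_ACm \<le>\<^sub>s dwD_ACm" "\<not> sdwD_ACm \<le>\<^sub>s dwD_ACm"
    using D incl deq succ_le_trans by blast+
  show ?thesis
    using incl eq deq D dwD_not_le_D 1 2 3 unfolding succ_less_def succ_equiv_def by blast
qed

end
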